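(* Let $N,n,k$ be positive integers. The canonical restriction map $$\mathbb C[V(N,n)]^{GL_N,-k}\longrightarrow\Gamma(\mathcal M(N,n),\mathcal L_{\det}^{\otimes k})$$ is an isomorphism; in particular $\mathcal H_N(n,k)\cong\Gamma(\mathcal M(N,n),\mathcal L_{\det}^{\otimes k})$.
   Context: $V(N,n)=\mathrm{End}(\mathbb C^N)\times\mathrm{Hom}(\mathbb C^n,\mathbb C^N)$ with $GL_N$-action $g\cdot(Z,\varphi)=(gZg^{-1},g\varphi)$; $\mathbb C[V(N,n)]$ is its coordinate ring with induced action $(g\cdot f)(v)=f(g^{-1}v)$, and $\mathbb C[V(N,n)]^{GL_N,m}$ is the subspace on which $GL_N$ acts through the character $g\mapsto\det(g)^m$. The Hilbert space of the Chern-Simons matrix model is $\mathcal H_N(n,k)=\mathbb C[V(N,n)]^{GL_N,-k}$. Let $R(N,n)=\{(Z,\varphi)\in V(N,n):\mathbb C[Z]\cdot\mathrm{Im}(\varphi)=\mathbb C^N\}$, an open subset on which $GL_N$ acts freely, and $\mathcal M(N,n)=R(N,n)/GL_N$, a smooth variety. $\mathcal L_{\det}$ is the determinant of the rank $N$ vector bundle $R(N,n)\times_{GL_N}\mathbb C^N\to\mathcal M(N,n)$. Its pullback to $R(N,n)$ is the trivial line bundle with equivariant structure given by the character $g\mapsto\det(g)$, so $\Gamma(\mathcal M(N,n),\mathcal L_{\det}^{\otimes k})=\Gamma(R(N,n),\mathcal O)^{GL_N,-k}$, and the canonical map is restriction of functions from $V(N,n)$ to $R(N,n)$. *)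

theory Defs
  imports "HOL-Analysis.Analysis" "HOL-Computational_Algebra.Polynomial"
begin

text \<open>
  The dimensions are \<open>N = CARD('N)\<close> and \<open>n = CARD('n)\<close>, both automatically positive.  A point of
  \<open>V(N,n)\<close> is a pair \<open>(Z, \<phi>)\<close> of an \<open>N \<times> N\<close> matrix and an \<open>N \<times> n\<close> matrix.
\<close>

type_synonym ('N, 'n) V = "(complex ^ 'N ^ 'N) \<times> (complex ^ 'n ^ 'N)"

definition GL :: "(complex ^ 'N ^ 'N) set" where
  "GL = {g. invertible g}"

definition act :: "complex ^ 'N ^ 'N \<Rightarrow> ('N::finite, 'n::finite) V \<Rightarrow> ('N, 'n) V" where
  "act g v = (g ** fst v ** matrix_inv g, g ** snd v)"

text \<open>
  \<open>\<complex>[V(N,n)]\<close> is realised as an algebra of functions (\<open>\<complex>\<close> is infinite, so polynomials and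
  polynomial functions agree).
\<close>

inductive_set coord_ring :: "(('N::finite, 'n::finite) V \<Rightarrow> complex) set" where
  const: "(\<lambda>v. c) \<in> coord_ring"
| coord_Z: "(\<lambda>v. fst v $ i $ j) \<in> coord_ring"
| coord_phi: "(\<lambda>v. snd v $ i $ a) \<in> coord_ring"
| add: "p \<in> coord_ring \<Longrightarrow> q \<in> coord_ring \<Longrightarrow> (\<lambda>v. p v + q v) \<in> coord_ring"
| mult: "p \<in> coord_ring \<Longrightarrow> q \<in> coord_ring \<Longrightarrow> (\<lambda>v. p v * q v) \<in> coord_ring"

text \<open>
  On a \<open>GL\<^sub>N\<close>-stable set \<open>X\<close>, the condition \<open>g \<cdot> f = det(g)\<^sup>m f\<close> for all \<open>g\<close>, where
  \<open>(g \<cdot> f)(v) = f(g\<^sup>-\<^sup>1 v)\<close>.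
\<close>

definition semi_invariant ::
    "('N::finite, 'n::finite) V set \<Rightarrow> int \<Rightarrow> (('N, 'n) V \<Rightarrow> complex) \<Rightarrow> bool" where
  "semi_invariant X m f \<longleftrightarrow>
     (\<forall>g\<in>GL. \<forall>v\<in>X. f (act (matrix_inv g) v) = det g powi m * f v)"

definition coord_ring_semi :: "int \<Rightarrow> (('N::finite, 'n::finite) V \<Rightarrow> complex) set" where
  "coord_ring_semi m = {f \<in> coord_ring. semi_invariant UNIV m f}"

text \<open>The underlying vector space of the Hilbert space of the Chern-Simons matrix model.\<close>

definition CS_Hilbert :: "nat \<Rightarrow> (('N::finite, 'n::finite) V \<Rightarrow> complex) set" where
  "CS_Hilbert k = coord_ring_semi (- int k)"

text \<open>
  \<open>poly_mv p Z w = p(Z) w\<close>.  Iterates of \<open>(*v) Z\<close> are used because \<open>Z ^ i\<close> on the vector type is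
  the componentwise power.
\<close>

definition poly_mv :: "complex poly \<Rightarrow> complex ^ 'N ^ 'N \<Rightarrow> complex ^ 'N \<Rightarrow> complex ^ 'N" where
  "poly_mv p Z w = (\<Sum>i\<le>degree p. coeff p i *s (((*v) Z) ^^ i) w)"

definition R_locus :: "('N::finite, 'n::finite) V set" where
  "R_locus = {(Z, \<phi>). vec.span {poly_mv p Z (\<phi> *v w) | p w. True} = UNIV}"

definition Zariski_open :: "('N::finite, 'n::finite) V set \<Rightarrow> bool" where
  "Zariski_open U \<longleftrightarrow> (\<exists>S\<subseteq>coord_ring. U = {v. \<exists>p\<in>S. p v \<noteq> 0})"

text \<open>
  Regular functions on a Zariski open \<open>X\<close>: locally a quotient of polynomials.  Functions on \<open>X\<close>
  are \<open>extensional\<close>, so that equality is equality on \<open>X\<close>.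
\<close>

definition regular_functions ::
    "('N::finite, 'n::finite) V set \<Rightarrow> (('N, 'n) V \<Rightarrow> complex) set" where
  "regular_functions X = {F \<in> extensional X. \<forall>x\<in>X. \<exists>U. Zariski_open U \<and> x \<in> U \<and> U \<subseteq> X \<and>
     (\<exists>p\<in>coord_ring. \<exists>q\<in>coord_ring. \<forall>y\<in>U. q y \<noteq> 0 \<and> F y = p y / q y)}"

definition regular_semi :: "int \<Rightarrow> (('N::finite, 'n::finite) V \<Rightarrow> complex) set" where
  "regular_semi m = {F \<in> regular_functions R_locus. semi_invariant R_locus m F}"

definition orbit :: "('N::finite, 'n::finite) V \<Rightarrow> ('N, 'n) V set" where
  "orbit x = (\<lambda>g. act g x) ` GL"

text \<open>The points of \<open>R(N,n)/GL\<^sub>N\<close>.\<close>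

definition moduli :: "('N::finite, 'n::finite) V set set" where
  "moduli = orbit ` R_locus"

text \<open>
  The determinant of the associated bundle \<open>R(N,n) \<times>\<^bsub>GL\<^esub> \<complex>\<^sup>N\<close> is the line bundle associated with
  the character \<open>det\<close>, so its \<open>k\<close>-th tensor power is \<open>R(N,n) \<times>\<^bsub>GL\<^esub> \<complex>\<close>, where \<open>GL\<^sub>N\<close> acts by
  \<open>g \<cdot> (x, c) = (g x, det(g)\<^sup>k c)\<close>.  The point \<open>[x, c]\<close> of its total space is \<open>Ldet_point k x c\<close>,
  and \<open>Ldet_fibre k m\<close> is the fibre over the orbit \<open>m\<close>.
\<close>

definition Ldet_point ::
    "nat \<Rightarrow> ('N::finite, 'n::finite) V \<Rightarrow> complex \<Rightarrow> (('N, 'n) V \<times> complex) set" where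
  "Ldet_point k x c = (\<lambda>g. (act g x, det g ^ k * c)) ` GL"

definition Ldet_fibre ::
    "nat \<Rightarrow> ('N::finite, 'n::finite) V set \<Rightarrow> (('N, 'n) V \<times> complex) set set" where
  "Ldet_fibre k m = {Ldet_point k x c | x c. x \<in> m}"

text \<open>
  Global sections of the \<open>k\<close>-th power of the determinant line bundle.  Regularity is tested on the
  pullback along \<open>R(N,n) \<rightarrow> R(N,n)/GL\<^sub>N\<close>, where the bundle is trivial: \<open>s\<close> is regular iff
  \<open>s([x]) = [x, F(x)]\<close> for a regular function \<open>F\<close> on \<open>R(N,n)\<close>.
\<close>

definition Ldet_sections ::
    "nat \<Rightarrow> (('N::finite, 'n::finite) V set \<Rightarrow> (('N, 'n) V \<times> complex) set) set" where
  "Ldet_sections k = {s \<in> Pi\<^sub>E moduli (Ldet_fibre k).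
     \<exists>F\<in>regular_functions R_locus. \<forall>x\<in>R_locus. s (orbit x) = Ldet_point k x (F x)}"

text \<open>Fibrewise operations: \<open>[x, a] + [x, b] = [x, a + b]\<close> and \<open>c [x, a] = [x, c a]\<close>.\<close>

definition section_add ::
    "(('N::finite, 'n::finite) V set \<Rightarrow> (('N, 'n) V \<times> complex) set) \<Rightarrow>
     (('N, 'n) V set \<Rightarrow> (('N, 'n) V \<times> complex) set) \<Rightarrow>
     ('N, 'n) V set \<Rightarrow> (('N, 'n) V \<times> complex) set" where
  "section_add s t = (\<lambda>m\<in>moduli. {(x, a + b) | x a b. (x, a) \<in> s m \<and> (x, b) \<in> t m})"

definition section_scale ::
    "complex \<Rightarrow> (('N::finite, 'n::finite) V set \<Rightarrow> (('N, 'n) V \<times> complex) set) \<Rightarrow>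
     ('N, 'n) V set \<Rightarrow> (('N, 'n) V \<times> complex) set" where
  "section_scale c s = (\<lambda>m\<in>moduli. {(x, c * a) | x a. (x, a) \<in> s m})"

text \<open>
  The section \<open>[x] \<mapsto> [x, F(x)]\<close>; for \<open>F\<close> semi-invariant of weight \<open>-k\<close> the union is over equal sets.
\<close>

definition descend ::
    "nat \<Rightarrow> (('N::finite, 'n::finite) V \<Rightarrow> complex) \<Rightarrow>
     ('N, 'n) V set \<Rightarrow> (('N, 'n) V \<times> complex) set" where
  "descend k F = (\<lambda>m\<in>moduli. \<Union>x\<in>m. Ldet_point k x (F x))"

definition linear_iso_between ::
    "'a set \<Rightarrow> ('a \<Rightarrow> 'a \<Rightarrow> 'a) \<Rightarrow> (complex \<Rightarrow> 'a \<Rightarrow> 'a) \<Rightarrow>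
     'b set \<Rightarrow> ('b \<Rightarrow> 'b \<Rightarrow> 'b) \<Rightarrow> (complex \<Rightarrow> 'b \<Rightarrow> 'b) \<Rightarrow> ('a \<Rightarrow> 'b) \<Rightarrow> bool" where
  "linear_iso_between A addA scaleA B addB scaleB T \<longleftrightarrow>
     bij_betw T A B \<and>
     (\<forall>f\<in>A. \<forall>g\<in>A. addA f g \<in> A \<and> T (addA f g) = addB (T f) (T g)) \<and>
     (\<forall>c. \<forall>f\<in>A. scaleA c f \<in> A \<and> T (scaleA c f) = scaleB c (T f))"

end

theory Submission
  imports Defs "HOL-Computational_Algebra.Fundamental_Theorem_Algebra"
begin

text \<open>
  For \<open>v = (Z, \<phi>)\<close> consider the matrices whose columns are vectors \<open>Z\<^sup>i \<phi>\<^sub>a\<close>; \<open>v\<close> lies in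
  \<open>R(N,n)\<close> iff one of them is invertible.  Let \<open>g\<close> be one with determinant of maximal modulus.  By
  Cramer's rule all \<open>g\<^sup>-\<^sup>1 Z\<^sup>i \<phi>\<^sub>a\<close> have entries bounded by 1, so \<open>g\<^sup>-\<^sup>1 v\<close> stays in a compact
  subset of \<open>R(N,n)\<close> as long as \<open>v\<close> is bounded.  Hence \<open>F(v) = det(g)\<^sup>k F(g\<^sup>-\<^sup>1 v)\<close> is bounded by a
  multiple of \<open>|det(g)|\<^sup>k\<close>, and since \<open>k > 0\<close> it tends to 0 at the complement of \<open>R(N,n)\<close>.  The
  extension of \<open>F\<close> by 0 is therefore continuous on \<open>V(N,n)\<close>.  A continuous function that is a
  quotient of polynomials on a dense open set is a polynomial: on a generic line it is a polynomial of
  bounded degree, and Lagrange interpolation in each coordinate reassembles it.  The argument needs no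
  codimension estimate, so the case \<open>n = 1\<close>, where the complement is a divisor, is not special.

  Sections of the line bundle correspond to semi-invariant functions because \<open>GL\<^sub>N\<close> acts freely on
  \<open>R(N,n)\<close>.
\<close>

section \<open>Polynomial functions along lines\<close>

lemma coord_ring_sum:
  "(\<And>i. i \<in> A \<Longrightarrow> f i \<in> coord_ring) \<Longrightarrow> (\<lambda>v. \<Sum>i\<in>A. f i v) \<in> coord_ring"
  by (induction A rule: infinite_finite_induct) (auto intro: coord_ring.intros)

lemma coord_ring_prod:
  "(\<And>i. i \<in> A \<Longrightarrow> f i \<in> coord_ring) \<Longrightarrow> (\<lambda>v. \<Prod>i\<in>A. f i v) \<in> coord_ring"
  by (induction A rule: infinite_finite_induct) (auto intro: coord_ring.intros)

lemma coord_ring_cmult: "p \<in> coord_ring \<Longrightarrow> (\<lambda>v. c * p v) \<in> coord_ring"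
  by (intro coord_ring.mult coord_ring.const)

lemma coord_ring_poly: "p \<in> coord_ring \<Longrightarrow> (\<lambda>v. poly P (p v)) \<in> coord_ring"
  by (induction P) (auto intro: coord_ring.intros)

section \<open>Determinants and continuity of polynomial functions\<close>

lemma coord_ring_det:
  assumes "\<And>i j. (\<lambda>v. A v $ i $ j) \<in> coord_ring"
  shows "(\<lambda>v. det (A v)) \<in> coord_ring"
  unfolding det_def using assms
  by (intro coord_ring_sum coord_ring_cmult coord_ring_prod)

lemma continuous_on_coord_ring: "p \<in> coord_ring \<Longrightarrow> continuous_on S p"
  by (induction rule: coord_ring.induct) (auto intro!: continuous_intros)

section \<open>Coordinates and norms on \<open>V(N,n)\<close>\<close>

fun coord :: "('N \<times> 'N) + ('N \<times> 'n) \<Rightarrow> ('N::finite, 'n::finite) V \<Rightarrow> complex" where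
  "coord (Inl (i, j)) v = fst v $ i $ j"
| "coord (Inr (i, a)) v = snd v $ i $ a"

definition of_coords :: "(('N \<times> 'N) + ('N \<times> 'n) \<Rightarrow> complex) \<Rightarrow> ('N::finite, 'n::finite) V" where
  "of_coords f = ((\<chi> i j. f (Inl (i, j))), (\<chi> i a. f (Inr (i, a))))"

lemma coord_of_coords [simp]: "coord l (of_coords f) = f l"
  by (cases l) (auto simp: of_coords_def)

lemma V_eqI: "(\<And>l. coord l v = coord l w) \<Longrightarrow> v = w"
  by (metis (no_types, lifting) coord.simps prod_eqI vec_eq_iff)

lemma of_coords_coord [simp]: "of_coords (\<lambda>l. coord l v) = v"
  by (rule V_eqI) simp

lemma coord_in_coord_ring: "(coord l :: ('N::finite, 'n::finite) V \<Rightarrow> complex) \<in> coord_ring"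
proof (cases l)
  case (Inl p)
  moreover have "coord (Inl p) = (\<lambda>v :: ('N, 'n) V. fst v $ fst p $ snd p)"
    by (cases p) (auto simp: fun_eq_iff)
  ultimately show ?thesis using coord_ring.coord_Z[of "fst p" "snd p"] by simp
next
  case (Inr p)
  moreover have "coord (Inr p) = (\<lambda>v :: ('N, 'n) V. snd v $ fst p $ snd p)"
    by (cases p) (auto simp: fun_eq_iff)
  ultimately show ?thesis using coord_ring.coord_phi[of "fst p" "snd p"] by simp
qed

lemma continuous_on_of_coords [continuous_intros]:
  "(\<And>l. continuous_on S (\<lambda>x. f x l)) \<Longrightarrow> continuous_on S (\<lambda>x. of_coords (f x))"
  unfolding of_coords_def by (auto intro!: continuous_intros)

lemma continuous_on_coord [continuous_intros]:
  assumes "continuous_on S f"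
  shows "continuous_on S (\<lambda>x. coord l (f x))"
  using continuous_on_compose2[OF continuous_on_coord_ring[OF coord_in_coord_ring[of l], of UNIV] assms]
  by simp

lemma norm_coord_le: "norm (coord l v) \<le> norm v"
proof (cases l)
  case (Inl p)
  then have "norm (coord l v) \<le> norm (fst v $ fst p)"
    using Finite_Cartesian_Product.norm_nth_le[of "fst v $ fst p" "snd p"] by (cases p) auto
  also have "\<dots> \<le> norm (fst v)"
    by (rule Finite_Cartesian_Product.norm_nth_le)
  also have "\<dots> \<le> norm v"
    using norm_fst_le[of "fst v" "snd v"] by simp
  finally show ?thesis .
next
  case (Inr p)
  then have "norm (coord l v) \<le> norm (snd v $ fst p)"
    using Finite_Cartesian_Product.norm_nth_le[of "snd v $ fst p" "snd p"] by (cases p) auto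
  also have "\<dots> \<le> norm (snd v)"
    by (rule Finite_Cartesian_Product.norm_nth_le)
  also have "\<dots> \<le> norm v"
    using norm_snd_le[of "snd v" "fst v"] by simp
  finally show ?thesis .
qed

text \<open>Converse to \<open>norm_coord_le\<close>: boundedness may be tested on coordinates. It
  supplies one half of the compactness of \<open>slice\<close>.\<close>

lemma bounded_coord:
  fixes S :: "('N::finite, 'n::finite) V set"
  assumes "\<And>v l. v \<in> S \<Longrightarrow> norm (coord l v) \<le> C"
  shows "bounded S"
proof (rule boundedI)
  fix v assume v: "v \<in> S"
  have *: "norm (A :: complex^'m^'N) \<le> real CARD('N) * (real CARD('m) * C)"
    if A: "\<And>i j. norm (A $ i $ j) \<le> C" for A :: "complex^('m::finite)^'N"
  proof -
    have "norm (A $ i) \<le> real CARD('m) * C" for i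
    proof -
      have "norm (A $ i) \<le> (\<Sum>j\<in>UNIV. norm (A $ i $ j))"
        unfolding norm_vec_def by (rule L2_set_le_sum) auto
      also have "\<dots> \<le> real CARD('m) * C"
        by (rule sum_bounded_above) (rule A)
      finally show ?thesis .
    qed
    then have "(\<Sum>i\<in>UNIV. norm (A $ i)) \<le> real CARD('N) * (real CARD('m) * C)"
      by (rule sum_bounded_above)
    moreover have "norm A \<le> (\<Sum>i\<in>UNIV. norm (A $ i))"
      unfolding norm_vec_def by (rule L2_set_le_sum) auto
    ultimately show ?thesis by linarith
  qed
  have "norm v \<le> norm (fst v) + norm (snd v)"
    by (metis norm_Pair_le prod.collapse)
  moreover have "norm (fst v $ i $ j) \<le> C" "norm (snd v $ i $ a) \<le> C" for i j a
    using assms[OF v, of "Inl (i, j)"] assms[OF v, of "Inr (i, a)"] by auto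
  ultimately show "norm v \<le> real CARD('N) * (real CARD('N) * C) + real CARD('N) * (real CARD('n) * C)"
    using *[of "fst v"] *[of "snd v"] by (meson add_mono order_trans)
qed

text \<open>Complex lines are written coordinatewise, with a complex parameter; \<open>b\<close> may
  vanish, so constant maps count as lines.\<close>

definition affine_line :: "(complex \<Rightarrow> ('N::finite, 'n::finite) V) \<Rightarrow> bool" where
  "affine_line L \<longleftrightarrow> (\<exists>a b. \<forall>l t. coord l (L t) = a l + t * b l)"

lemma affine_lineI: "(\<And>l t. coord l (L t) = a l + t * b l) \<Longrightarrow> affine_line L"
  unfolding affine_line_def by blast

text \<open>The point is the order of quantifiers: one \<open>d\<close> serves all lines, so that
  later one set of interpolation nodes serves all base points. Degrees are bounded by a maximum for
  sums and by a sum for products.\<close>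

lemma coord_ring_affine_line:
  fixes p :: "('N::finite, 'n::finite) V \<Rightarrow> complex"
  assumes "p \<in> coord_ring"
  obtains d where "\<And>L. affine_line L \<Longrightarrow> \<exists>P. degree P \<le> d \<and> (\<forall>t. p (L t) = poly P t)"
proof -
  have "\<exists>d. \<forall>L. affine_line L \<longrightarrow>
    (\<exists>P. degree P \<le> d \<and> (\<forall>t. p (L t) = poly P t))"
    using assms
  proof (induction rule: coord_ring.induct)
    case (const c)
    show ?case
      by (intro exI[of _ "0::nat"] allI impI exI[of _ "[:c:]"]) auto
  next
    case (coord_Z i j)
    show ?case
    proof (intro exI[of _ "1::nat"] allI impI)
      fix L :: "complex \<Rightarrow> ('N, 'n) V"
      assume "affine_line L"
      then obtain a b where *: "\<forall>l t. coord l (L t) = a l + t * b l"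
        by (auto simp: affine_line_def)
      have "fst (L t) $ i $ j = poly [:a (Inl (i,j)), b (Inl (i,j)):] t" for t
        using *[rule_format, of "Inl (i,j)" t] by simp
      moreover have "degree [:a (Inl (i,j)), b (Inl (i,j)):] \<le> 1"
        by simp
      ultimately show "\<exists>P. degree P \<le> 1 \<and> (\<forall>t. fst (L t) $ i $ j = poly P t)"
        by blast
    qed
  next
    case (coord_phi i j)
    show ?case
    proof (intro exI[of _ "1::nat"] allI impI)
      fix L :: "complex \<Rightarrow> ('N, 'n) V"
      assume "affine_line L"
      then obtain a b where *: "\<forall>l t. coord l (L t) = a l + t * b l"
        by (auto simp: affine_line_def)
      have "snd (L t) $ i $ j = poly [:a (Inr (i,j)), b (Inr (i,j)):] t" for t
        using *[rule_format, of "Inr (i,j)" t] by simp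
      moreover have "degree [:a (Inr (i,j)), b (Inr (i,j)):] \<le> 1"
        by simp
      ultimately show "\<exists>P. degree P \<le> 1 \<and> (\<forall>t. snd (L t) $ i $ j = poly P t)"
        by blast
    qed
  next
    case (add p q)
    then obtain d e where
      d: "\<forall>L. affine_line L \<longrightarrow> (\<exists>P. degree P \<le> d \<and> (\<forall>t. p (L t) = poly P t))" and
      e: "\<forall>L. affine_line L \<longrightarrow> (\<exists>P. degree P \<le> e \<and> (\<forall>t. q (L t) = poly P t))"
      by blast
    show ?case
    proof (intro exI[of _ "max d e"] allI impI)
      fix L :: "complex \<Rightarrow> ('N, 'n) V"
      assume *: "affine_line L"
      obtain P Q where "degree P \<le> d" "\<forall>t. p (L t) = poly P t" "degree Q \<le> e" "\<forall>t. q (L t) = poly Q t"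
        using d e * by meson
      then show "\<exists>P. degree P \<le> max d e \<and> (\<forall>t. p (L t) + q (L t) = poly P t)"
        by (intro exI[of _ "P + Q"]) (auto intro: degree_add_le)
    qed
  next
    case (mult p q)
    then obtain d e where
      d: "\<forall>L. affine_line L \<longrightarrow> (\<exists>P. degree P \<le> d \<and> (\<forall>t. p (L t) = poly P t))" and
      e: "\<forall>L. affine_line L \<longrightarrow> (\<exists>P. degree P \<le> e \<and> (\<forall>t. q (L t) = poly P t))"
      by blast
    show ?case
    proof (intro exI[of _ "d + e"] allI impI)
      fix L :: "complex \<Rightarrow> ('N, 'n) V"
      assume *: "affine_line L"
      obtain P Q where "degree P \<le> d" "\<forall>t. p (L t) = poly P t" "degree Q \<le> e" "\<forall>t. q (L t) = poly Q t"
        using d e * by meson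
      then show "\<exists>P. degree P \<le> d + e \<and> (\<forall>t. p (L t) * q (L t) = poly P t)"
        by (intro exI[of _ "P * Q"]) (auto intro: order_trans[OF degree_mult_le])
    qed
  qed
  then obtain d where d: "\<forall>L. affine_line L \<longrightarrow>
    (\<exists>P. degree P \<le> d \<and> (\<forall>t. p (L t) = poly P t))"
    by blast
  show ?thesis
    by (rule that[of d]) (use d in simp)
qed

text \<open>On the line from \<open>x\<close> to \<open>x0\<close> the function \<open>p\<close> is
  a nonzero polynomial in one variable, so it has finitely many zeros there, and \<open>x\<close> is
  a limit of points of the line where \<open>p\<close> does not vanish.\<close>

lemma coord_ring_nonzero_dense:
  assumes p: "p \<in> coord_ring" and x0: "p x0 \<noteq> 0"
  shows "closure {v. p v \<noteq> 0} = UNIV"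
proof -
  have "x \<in> closure {v. p v \<noteq> 0}" for x
  proof -
    define L where "L t = of_coords (\<lambda>l. coord l x + t * (coord l x0 - coord l x))" for t
    have "coord l (L t) = coord l x + t * (coord l x0 - coord l x)" for l t
      by (simp add: L_def)
    then have "affine_line L"
      by (rule affine_lineI)
    then obtain P where P: "\<And>t. p (L t) = poly P t"
      using coord_ring_affine_line[OF p] by metis
    have L: "L 0 = x" "L 1 = x0"
      by (auto simp: L_def)
    then have "P \<noteq> 0"
      using x0 P[of 1] by auto
    then have "finite {t. poly P t = 0}"
      by (rule poly_roots_finite)
    \<comment> \<open>The point 0 is put back because \<open>x\<close> itself may be a zero of
      \<open>p\<close>; the punctured filter \<open>at 0\<close> ignores it.\<close>
    then have "open (- ({t. poly P t = 0} - {0}))"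
      by (intro open_Compl finite_imp_closed) auto
    then have "\<forall>\<^sub>F t in nhds 0. t \<in> - ({t. poly P t = 0} - {0})"
      by (rule eventually_nhds_in_open) auto
    then have "\<forall>\<^sub>F t in at 0. poly P t \<noteq> 0"
      unfolding eventually_at_filter by eventually_elim auto
    then have "\<forall>\<^sub>F t in at 0. L t \<in> {v. p v \<noteq> 0}"
      by (simp add: P)
    moreover have "continuous_on UNIV L"
      unfolding L_def by (intro continuous_intros)
    then have "(L \<longlongrightarrow> L 0) (at 0)"
      by (simp add: continuous_on_def)
    ultimately show ?thesis
      using closure_subset[of "{v. p v \<noteq> 0}"] L
      by (metis (mono_tags, lifting) Lim_in_closed_set closed_closure eventually_mono subsetD
          trivial_limit_at)
  qed
  then show ?thesis by blast
qed

section \<open>Continuous quotients of polynomials in one variable\<close>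

lemma continuous_eq_on_dense:
  fixes f g :: "'a::topological_space \<Rightarrow> complex"
  assumes "continuous_on UNIV f" "continuous_on UNIV g" "closure S = UNIV"
    and "\<And>v. v \<in> S \<Longrightarrow> f v = g v"
  shows "f v = g v"
proof -
  have "closed {v. f v = g v}"
    using assms(1,2) by (rule closed_Collect_eq)
  then have "closure S \<subseteq> {v. f v = g v}"
    using assms(4) by (intro closure_minimal) auto
  then show ?thesis using assms(3) by auto
qed

text \<open>Induction on \<open>degree q\<close>. A root of \<open>q\<close> is also a root of
  \<open>p\<close>, since \<open>f\<close> has a finite value there, and the common linear factor
  cancels. Without roots \<open>q\<close> is a constant, by the fundamental theorem of
  algebra.\<close>

lemma continuous_quotient_poly:
  fixes f :: "complex \<Rightarrow> complex"
  assumes "continuous_on UNIV f" "q \<noteq> 0" "\<And>t. f t * poly q t = poly p t"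
  shows "\<exists>P. degree P \<le> degree p \<and> (\<forall>t. f t = poly P t)"
  using assms
proof (induction "degree q" arbitrary: p q rule: less_induct)
  case less
  show ?case
  proof (cases "\<exists>a. poly q a = 0")
    case False
    then have "degree q = 0"
      using fundamental_theorem_of_algebra_alt[of q] by (metis degree_pCons_0)
    then obtain c where c: "q = [:c:]" "c \<noteq> 0"
      using less.prems by (metis degree_eq_zeroE pCons_0_0)
    have "f t = poly (smult (inverse c) p) t" for t
      using less.prems(3)[of t] c by (auto simp: field_simps)
    then show ?thesis
      by (metis degree_smult_le)
  next
    case True
    then obtain a q' where q': "q = [:-a, 1:] * q'"
      by (metis dvdE poly_eq_0_iff_dvd)
    moreover have "poly p a = 0"
      using less.prems(3)[of a] q' by auto
    then obtain p' where p': "p = [:-a, 1:] * p'"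
      by (metis dvdE poly_eq_0_iff_dvd)
    have "q' \<noteq> 0" using q' less.prems by auto
    have deg: "degree q' < degree q"
      using q' \<open>q' \<noteq> 0\<close> by (auto simp: degree_mult_eq simp del: mult_pCons_left)
    have eq: "f t * poly q' t = poly p' t" if "t \<in> - {a}" for t
    proof -
      have "(t - a) * (f t * poly q' t) = (t - a) * poly p' t"
        using less.prems(3)[of t] by (simp add: q' p' algebra_simps)
      then show ?thesis using that by simp
    qed
    \<comment> \<open>Cancelling \<open>t - a\<close> gives the identity only away from
      \<open>a\<close>; continuity of \<open>f\<close> restores it at \<open>a\<close>.\<close>
    have "closure (- {a}) = (UNIV :: complex set)"
      by (simp add: closure_complement)
    moreover have "continuous_on UNIV (\<lambda>t. f t * poly q' t)" "continuous_on UNIV (poly p')"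
      using less.prems(1) by (auto intro!: continuous_intros)
    ultimately have "f t * poly q' t = poly p' t" for t
      using continuous_eq_on_dense eq by blast
    from less.hyps[OF deg less.prems(1) \<open>q' \<noteq> 0\<close> this]
    obtain P where "degree P \<le> degree p'" "\<forall>t. f t = poly P t" by blast
    moreover have "degree p' \<le> degree p"
      by (cases "p' = 0") (auto simp: p' degree_mult_eq simp del: mult_pCons_left)
    ultimately show ?thesis
      by (meson order_trans)
  qed
qed

section \<open>Lagrange interpolation at the nodes 0, ..., d\<close>

definition lagrange :: "nat \<Rightarrow> nat \<Rightarrow> complex poly" where
  "lagrange d j = smult (inverse (\<Prod>i\<in>{..d}-{j}. of_nat j - of_nat i)) (\<Prod>i\<in>{..d}-{j}. [:- of_nat i, 1:])"

lemma poly_lagrange: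
  assumes "i \<le> d" "j \<le> d"
  shows "poly (lagrange d j) (of_nat i) = (if i = j then 1 else 0)"
proof (cases "i = j")
  case False
  then show ?thesis
    using assms by (auto simp: lagrange_def poly_prod prod_zero_iff)
next
  case True
  have "(\<Prod>i\<in>{..d}-{j}. complex_of_nat j - of_nat i) \<noteq> 0"
    by (auto simp: prod_zero_iff)
  then show ?thesis
    using True by (simp add: lagrange_def poly_prod)
qed

lemma degree_lagrange: "j \<le> d \<Longrightarrow> degree (lagrange d j) \<le> d"
proof -
  assume "j \<le> d"
  have "degree (\<Prod>i\<in>{..d}-{j}. [:- complex_of_nat i, 1:]) \<le> (\<Sum>i\<in>{..d}-{j}. 1)"
    by (rule order_trans[OF degree_prod_sum_le]) (auto simp: o_def)
  then show ?thesis
    using \<open>j \<le> d\<close> by (auto simp: lagrange_def card_Diff_singleton)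
qed

text \<open>Both sides have degree at most \<open>d\<close> and agree at the \<open>d + 1\<close>
  nodes.\<close>

lemma lagrange_interpolation:
  fixes P :: "complex poly"
  assumes "degree P \<le> d"
  shows "poly P t = (\<Sum>j\<le>d. poly P (of_nat j) * poly (lagrange d j) t)"
proof -
  have "P = (\<Sum>j\<le>d. smult (poly P (of_nat j)) (lagrange d j))" (is "_ = ?Q")
  proof (rule poly_eqI_degree[where A = "of_nat ` {..d}"])
    show "poly P x = poly ?Q x" if "x \<in> of_nat ` {..d}" for x
      using that by (auto simp: poly_sum poly_lagrange if_distrib[where f = "(*) _"] cong: if_cong)
    have "card (of_nat ` {..d} :: complex set) = Suc d"
      by (subst card_image) (auto simp: inj_on_def)
    moreover have "degree ?Q \<le> d"
      by (intro degree_sum_le) (auto intro: order_trans[OF degree_smult_le] degree_lagrange)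
    ultimately show "card (of_nat ` {..d} :: complex set) > degree P"
      "card (of_nat ` {..d} :: complex set) > degree ?Q"
      using assms by auto
  qed
  then have "poly P t = poly ?Q t" by simp
  then show ?thesis by (simp add: poly_sum)
qed

section \<open>Interpolation in one coordinate at a time\<close>

definition upd :: "('N \<times> 'N) + ('N \<times> 'n) \<Rightarrow> complex \<Rightarrow> ('N::finite, 'n::finite) V \<Rightarrow> ('N, 'n) V" where
  "upd l t v = of_coords ((\<lambda>m. coord m v)(l := t))"

lemma coord_upd [simp]: "coord m (upd l t v) = (if m = l then t else coord m v)"
  by (simp add: upd_def)

lemma upd_coord: "upd l (coord l v) v = v"
  by (rule V_eqI) simp

lemma upd_commute: "l \<noteq> m \<Longrightarrow> upd l s (upd m t v) = upd m t (upd l s v)"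
  by (rule V_eqI) simp

lemma continuous_on_upd:
  assumes "continuous_on S f" "continuous_on S g"
  shows "continuous_on S (\<lambda>x. upd l (f x) (g x))"
  unfolding upd_def
proof (rule continuous_on_of_coords)
  show "continuous_on S (\<lambda>x. ((\<lambda>m. coord m (g x))(l := f x)) m)" for m
    using assms by (cases "m = l") (auto intro: continuous_intros)
qed

text \<open>Induction on the set \<open>A\<close> of coordinates on which \<open>G\<close> depends.
  Interpolation in \<open>l\<close> writes \<open>G\<close> through the functions
  \<open>G (upd l (of_nat j) v)\<close>, which no longer see \<open>l\<close>; they inherit the
  other interpolation formulas because updates of different coordinates commute.\<close>

lemma separately_polynomial_imp_coord_ring:
  fixes G :: "('N::finite, 'n::finite) V \<Rightarrow> complex"
  assumes "finite A"
    and "\<And>v w. (\<And>l. l \<in> A \<Longrightarrow> coord l v = coord l w) \<Longrightarrow> G v = G w"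
    and "\<And>l. l \<in> A \<Longrightarrow> \<exists>d. \<forall>v. G v = (\<Sum>j\<le>d. G (upd l (of_nat j) v) * poly (lagrange d j) (coord l v))"
  shows "G \<in> coord_ring"
  using assms
proof (induction A arbitrary: G rule: finite_induct)
  case empty
  then have "G = (\<lambda>v. G undefined)" by blast
  then show ?case by (metis coord_ring.const)
next
  case (insert l A)
  obtain d where d: "\<And>v. G v = (\<Sum>j\<le>d. G (upd l (of_nat j) v) * poly (lagrange d j) (coord l v))"
    using insert.prems(2)[of l] by auto
  have "(\<lambda>v. G (upd l (of_nat j) v)) \<in> coord_ring" for j
  proof (rule insert.IH)
    show "G (upd l (of_nat j) v) = G (upd l (of_nat j) w)"
      if "\<And>l. l \<in> A \<Longrightarrow> coord l v = coord l w" for v w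
      by (rule insert.prems(1)) (use that in auto)
    show "\<exists>e. \<forall>v. G (upd l (of_nat j) v) =
        (\<Sum>i\<le>e. G (upd l (of_nat j) (upd m (of_nat i) v)) * poly (lagrange e i) (coord m v))" if m: "m \<in> A" for m
    proof -
      have "m \<noteq> l" using that insert.hyps by auto
      obtain e where e: "\<forall>v. G v = (\<Sum>i\<le>e. G (upd m (of_nat i) v) * poly (lagrange e i) (coord m v))"
        using insert.prems(2)[OF insertI2[OF m]] by blast
      show ?thesis
      proof (intro exI allI)
        fix v
        show "G (upd l (of_nat j) v) =
          (\<Sum>i\<le>e. G (upd l (of_nat j) (upd m (of_nat i) v)) * poly (lagrange e i) (coord m v))"
          using e[rule_format, of "upd l (of_nat j) v"]
          by (simp add: upd_commute[OF \<open>m \<noteq> l\<close>, of _ "of_nat j"] \<open>m \<noteq> l\<close>)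
      qed
    qed
  qed
  then have "(\<lambda>v. \<Sum>j\<le>d. G (upd l (of_nat j) v) * poly (lagrange d j) (coord l v)) \<in> coord_ring"
    by (intro coord_ring_sum coord_ring.mult coord_ring_poly coord_in_coord_ring)
  then show ?case
    by (subst (asm) d[symmetric])
qed

text \<open>On a coordinate line where \<open>q\<close> is not identically zero, \<open>F\<close> is
  a polynomial of degree at most the uniform bound \<open>d\<close> for \<open>p\<close>. The
  resulting interpolation formula holds on a dense set, and both of its sides are
  continuous.\<close>

lemma continuous_quotient_in_coord_ring:
  fixes F :: "('N::finite, 'n::finite) V \<Rightarrow> complex"
  assumes F: "continuous_on UNIV F" and p: "p \<in> coord_ring" and q: "q \<in> coord_ring"
    and x0: "q x0 \<noteq> 0" and eq: "\<And>v. F v * q v = p v"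
  shows "F \<in> coord_ring"
proof (rule separately_polynomial_imp_coord_ring[of UNIV])
  show "F v = F w" if "\<And>l. l \<in> UNIV \<Longrightarrow> coord l v = coord l w" for v w
    using that by (metis UNIV_I V_eqI)
  obtain d where d: "\<And>L. affine_line L \<Longrightarrow> \<exists>P. degree P \<le> d \<and> (\<forall>t. p (L t) = poly P t)"
    using coord_ring_affine_line[OF p] by blast
  obtain e where e: "\<And>L. affine_line L \<Longrightarrow> \<exists>P. degree P \<le> e \<and> (\<forall>t. q (L t) = poly P t)"
    using coord_ring_affine_line[OF q] by blast
  fix l
  have "F v = (\<Sum>j\<le>d. F (upd l (of_nat j) v) * poly (lagrange d j) (coord l v))" for v
  proof (rule continuous_eq_on_dense[OF F _ coord_ring_nonzero_dense[OF q x0]])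
    show "continuous_on UNIV (\<lambda>v. \<Sum>j\<le>d. F (upd l (of_nat j) v) * poly (lagrange d j) (coord l v))"
      by (intro continuous_intros continuous_on_compose2[OF F] continuous_on_upd) auto
    fix v assume v: "v \<in> {v. q v \<noteq> 0}"
    have "coord m (upd l t v) = (if m = l then 0 else coord m v) + t * (if m = l then 1 else 0)" for m t
      by simp
    then have line: "affine_line (\<lambda>t. upd l t v)"
      by (rule affine_lineI)
    obtain P Q where P: "degree P \<le> d" "\<And>t. p (upd l t v) = poly P t" 
        and Q: "\<And>t. q (upd l t v) = poly Q t"
      using d[OF line] e[OF line] by metis
    \<comment> \<open>The line passes through \<open>v\<close> at parameter
      \<open>coord l v\<close>, and \<open>q v \<noteq> 0\<close>, so \<open>q\<close> does not
      vanish identically on it.\<close>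
    have "poly Q (coord l v) \<noteq> 0"
      using v by (simp flip: Q add: upd_coord)
    then have "Q \<noteq> 0" by auto
    have "\<exists>R. degree R \<le> degree P \<and> (\<forall>t. F (upd l t v) = poly R t)"
      by (rule continuous_quotient_poly[OF _ \<open>Q \<noteq> 0\<close>])
        (auto simp: eq simp flip: P(2) Q intro!: continuous_on_compose2[OF F] continuous_on_upd continuous_intros)
    then obtain R where R: "degree R \<le> d" "\<And>t. F (upd l t v) = poly R t"
      using P(1) order_trans by blast
    show "F v = (\<Sum>j\<le>d. F (upd l (of_nat j) v) * poly (lagrange d j) (coord l v))"
      using lagrange_interpolation[OF R(1), of "coord l v"] by (simp flip: R(2) add: upd_coord)
  qed
  then show "\<exists>d. \<forall>v. F v = (\<Sum>j\<le>d. F (upd l (of_nat j) v) * poly (lagrange d j) (coord l v))"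
    by blast
qed simp

section \<open>Annihilating polynomials with bounded coefficients\<close>

lemma poly_mv_eq_sum:
  assumes "degree p \<le> d"
  shows "poly_mv p Z w = (\<Sum>i\<le>d. coeff p i *s (((*v) Z) ^^ i) w)"
  unfolding poly_mv_def using assms
  by (intro sum.mono_neutral_left) (auto simp: coeff_eq_0)

lemma poly_mv_0 [simp]: "poly_mv 0 Z w = 0"
  by (simp add: poly_mv_def)

lemma poly_mv_add: "poly_mv (p + q) Z w = poly_mv p Z w + poly_mv q Z w"
proof -
  have "degree (p + q) \<le> max (degree p) (degree q)"
    by (rule degree_add_le_max)
  then show ?thesis
    by (simp add: poly_mv_eq_sum[of _ "max (degree p) (degree q)"] sum.distrib vec.scale_left_distrib)
qed

lemma poly_mv_smult: "poly_mv (smult a p) Z w = a *s poly_mv p Z w"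
  by (simp add: poly_mv_eq_sum[of _ "degree p"] degree_smult_le vec.scale_sum_right)

lemma matrix_vector_mult_sum_right: "A *v (\<Sum>i\<in>S. f i) = (\<Sum>i\<in>S. A *v (f i :: complex^_))"
  by (induction S rule: infinite_finite_induct) (auto simp: matrix_vector_right_distrib)

lemma poly_mv_pCons: "poly_mv (pCons a p) Z w = a *s w + Z *v poly_mv p Z w"
proof -
  have "poly_mv (pCons a p) Z w = (\<Sum>i\<le>Suc (degree p). coeff (pCons a p) i *s (((*v) Z) ^^ i) w)"
    by (rule poly_mv_eq_sum) (rule degree_pCons_le)
  also have "\<dots> = a *s w + Z *v poly_mv p Z w"
    by (subst sum.atMost_Suc_shift)
       (simp add: poly_mv_eq_sum[of p "degree p"] matrix_vector_mult_sum_right vec.scale)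
  finally show ?thesis .
qed

lemma poly_mv_linear_factor:
  "poly_mv ([:- a, 1:] * q) Z w = Z *v poly_mv q Z w - a *s poly_mv q Z w"
proof -
  have "[:- a, 1:] * q = smult (- a) q + pCons 0 q"
    by simp
  then show ?thesis
    by (simp only: poly_mv_add poly_mv_smult poly_mv_pCons) simp
qed

lemma poly_mv_monom_mult: "poly_mv (monom 1 k * q) Z w = (((*v) Z) ^^ k) (poly_mv q Z w)"
  by (induction k) (auto simp: monom_Suc poly_mv_pCons simp flip: one_pCons)

text \<open>Concerns a family rather than a set: if two members coincide, the coefficients 1 and -1
  give the relation.\<close>

lemma real_dependence:
  fixes f :: "nat \<Rightarrow> 'a::euclidean_space"
  shows "\<exists>c. (\<exists>i\<le>DIM('a). c i \<noteq> 0) \<and> (\<Sum>i\<le>DIM('a). c i *\<^sub>R f i) = 0"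
proof (cases "inj_on f {..DIM('a)}")
  case True
  then have "dependent (f ` {..DIM('a)})"
    by (intro dependent_biggerset) (auto simp: card_image)
  then obtain u v where u: "v \<in> f ` {..DIM('a)}" "u v \<noteq> 0" "(\<Sum>v\<in>f ` {..DIM('a)}. u v *\<^sub>R v) = 0"
    by (auto simp: dependent_finite)
  then show ?thesis
    using True by (intro exI[of _ "u \<circ> f"]) (auto simp: sum.reindex)
next
  case False
  then obtain i j where ij: "i \<le> DIM('a)" "j \<le> DIM('a)" "i \<noteq> j" "f i = f j"
    by (auto simp: inj_on_def)
  have "(\<Sum>k\<le>DIM('a). (if k = i then 1 else if k = j then -1 else 0) *\<^sub>R f k)
    = (\<Sum>k\<in>{i,j}. (if k = i then 1 else if k = j then -1 else 0) *\<^sub>R f k)"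
    using ij by (intro sum.mono_neutral_right) auto
  also have "\<dots> = 0" using ij by simp
  finally show ?thesis
    using ij by (intro exI[of _ "\<lambda>k. if k = i then 1 else if k = j then -1 else 0"]) auto
qed

text \<open>The powers of \<open>Z\<close> with exponents 0 up to the real dimension of the matrix
  space are one too many to be independent over the reals.\<close>

lemma exists_annihilator:
  fixes Z :: "complex^'N^'N"
  shows "\<exists>p. p \<noteq> 0 \<and> degree p \<le> DIM(complex^'N^'N) \<and> (\<forall>w. poly_mv p Z w = 0)"
proof -
  define f where "f i = (((**) Z) ^^ i) (mat 1)" for i
  have f: "f i *v w = (((*v) Z) ^^ i) w" for i w
    by (induction i) (auto simp: f_def simp flip: matrix_vector_mul_assoc)
  obtain c i where ci: "i \<le> DIM(complex^'N^'N)" "c i \<noteq> 0" 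
    "(\<Sum>i\<le>DIM(complex^'N^'N). c i *\<^sub>R f i) = 0"
    using real_dependence[of f] by blast
  define p where "p = (\<Sum>i\<le>DIM(complex^'N^'N). monom (complex_of_real (c i)) i)"
  have coeff: "coeff p i = (if i \<le> DIM(complex^'N^'N) then of_real (c i) else 0)" for i
    by (simp add: p_def coeff_sum)
  have deg: "degree p \<le> DIM(complex^'N^'N)"
    by (rule degree_le) (simp add: coeff)
  have sum: "(\<Sum>i\<in>S. c i *\<^sub>R f i) *v w = (\<Sum>i\<in>S. of_real (c i) *s (f i *v w))" for S w
  proof (induction S rule: infinite_finite_induct)
    case (insert i S)
    have "(c i *\<^sub>R f i) *v w = of_real (c i) *s (f i *v w)"
      by (simp add: vec_eq_iff matrix_vector_mult_def sum_distrib_left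
          scaleR_conv_of_real[where 'a = complex] mult.assoc)
    then show ?case
      using insert by (simp add: matrix_vector_mult_add_rdistrib)
  qed auto
  have "poly_mv p Z w = 0" for w
  proof -
    have "poly_mv p Z w = (\<Sum>i\<le>DIM(complex^'N^'N). of_real (c i) *s (((*v) Z) ^^ i) w)"
      unfolding poly_mv_eq_sum[OF deg] by (rule sum.cong) (auto simp: coeff)
    also have "\<dots> = 0"
      using sum[of "{..DIM(complex^'N^'N)}" w] unfolding ci(3) f by simp
    finally show ?thesis .
  qed
  moreover have "p \<noteq> 0"
    using coeff[of i] ci by auto
  ultimately show ?thesis using deg by blast
qed

text \<open>Compare the two sides of the eigenvalue equation in a coordinate where \<open>u\<close>
  has maximal modulus.\<close>

lemma eigenvalue_bound:
  fixes Z :: "complex^'N^'N"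
  assumes "\<And>i j. norm (Z $ i $ j) \<le> C" "Z *v u = a *s u" "u \<noteq> 0"
  shows "norm a \<le> real CARD('N) * C"
proof -
  have "Max (range (\<lambda>i. norm (u $ i))) \<in> range (\<lambda>i. norm (u $ i))"
    by (rule Max_in) auto
  then obtain i where "norm (u $ i) = Max (range (\<lambda>i. norm (u $ i)))"
    by (metis (no_types, lifting) imageE)
  then have max: "norm (u $ j) \<le> norm (u $ i)" for j
    by simp
  have "u $ i \<noteq> 0"
    using max \<open>u \<noteq> 0\<close> by (metis norm_le_zero_iff norm_zero vec_eq_iff zero_index)
  have "0 \<le> C"
    using assms(1)[of i i] norm_ge_zero order_trans by blast
  have "norm a * norm (u $ i) = norm ((Z *v u) $ i)"
    using assms(2) by (simp add: norm_mult)
  also have "\<dots> \<le> (\<Sum>j\<in>UNIV. norm (Z $ i $ j * u $ j))"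
    by (simp add: matrix_vector_mult_def norm_sum)
  also have "\<dots> \<le> real CARD('N) * (C * norm (u $ i))"
    by (rule sum_bounded_above)
       (auto simp: norm_mult intro!: mult_mono assms(1) max \<open>0 \<le> C\<close>)
  finally have "norm a * norm (u $ i) \<le> (real CARD('N) * C) * norm (u $ i)"
    by (simp add: mult.assoc)
  then show ?thesis
    using \<open>u $ i \<noteq> 0\<close> by simp
qed

text \<open>Induction on the degree: splitting off a root \<open>a\<close> gives each coefficient of
  \<open>p\<close> as \<open>- a\<close> times a coefficient of \<open>q\<close> plus the preceding
  one, whence the bound \<open>R * B + B\<close>.\<close>

lemma monic_coeff_bound:
  assumes "0 \<le> R"
  shows "\<exists>B. \<forall>p :: complex poly. degree p = d \<and> lead_coeff p = 1 \<and> (\<forall>z. poly p z = 0 \<longrightarrow> norm z \<le> R)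
    \<longrightarrow> (\<forall>i. norm (coeff p i) \<le> B)"
proof (induction d)
  case 0
  have "norm (coeff p i) \<le> 1" if "degree p = 0" "lead_coeff p = 1" for i and p :: "complex poly"
    using that by (cases "i = 0") (auto simp: coeff_eq_0)
  then show ?case by blast
next
  case (Suc d)
  then obtain B where B: "\<forall>p :: complex poly. degree p = d \<and> lead_coeff p = 1 \<and>
      (\<forall>z. poly p z = 0 \<longrightarrow> norm z \<le> R) \<longrightarrow> (\<forall>i. norm (coeff p i) \<le> B)"
    by blast
  have "norm (coeff p i) \<le> R * B + B"
    if p: "degree p = Suc d" "lead_coeff p = 1" "\<forall>z. poly p z = 0 \<longrightarrow> norm z \<le> R"
    for i and p :: "complex poly"
  proof -
    have "\<exists>a. poly p a = 0"
      using fundamental_theorem_of_algebra_alt[of p] p(1)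
      by (metis Zero_not_Suc degree_pCons_0)
    then obtain a q where q: "p = [:-a, 1:] * q" and a: "poly p a = 0"
      by (metis dvdE poly_eq_0_iff_dvd)
    have "q \<noteq> 0" using q p(1) by auto
    then have "degree q = d" "lead_coeff q = 1"
      using q p(1,2) degree_mult_eq[of "[:-a, 1:]" q] lead_coeff_mult[of "[:-a, 1:]" q] by auto
    moreover have "norm z \<le> R" if "poly q z = 0" for z
      using p(3) that by (simp add: q)
    ultimately have Bq: "norm (coeff q j) \<le> B" for j
      using B by blast
    then have "0 \<le> B"
      using norm_ge_zero order_trans by blast
    have "coeff p i = - a * coeff q i + (if i = 0 then 0 else coeff q (i - 1))"
      by (simp add: q coeff_pCons split: nat.split)
    then have "norm (coeff p i) \<le> norm (- a * coeff q i) + norm (if i = 0 then 0 else coeff q (i - 1))"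
      by (metis norm_triangle_ineq)
    also have "\<dots> \<le> R * B + B"
      using a p(3) Bq \<open>0 \<le> B\<close> \<open>0 \<le> R\<close> by (intro add_mono) (auto simp: norm_mult intro!: mult_mono)
    finally show ?thesis .
  qed
  then show ?case by blast
qed

text \<open>
  The roots of the minimal polynomial are eigenvalues, so they are bounded in terms of the entries;
  multiplying by a power of the variable makes the degree independent of the matrix.
\<close>

lemma bounded_annihilator:
  obtains B where "\<And>Z :: complex^'N^'N. (\<And>i j. norm (Z $ i $ j) \<le> C) \<Longrightarrow>
    \<exists>c. (\<forall>i. norm (c i) \<le> B) \<and>
      (\<forall>w. (((*v) Z) ^^ DIM(complex^'N^'N)) w = (\<Sum>i<DIM(complex^'N^'N). c i *s (((*v) Z) ^^ i) w))"
proof (cases "0 \<le> C")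
  case False
  then have "\<not> norm (Z $ i $ j) \<le> C" for Z :: "complex^'N^'N" and i j
    using norm_ge_zero[of "Z $ i $ j"] by linarith
  then show ?thesis using that by blast
next
  case True
  let ?D = "DIM(complex^'N^'N)"
  let ?R = "real CARD('N) * C"
  have "0 \<le> ?R" using True by simp
  then obtain B where B: "\<forall>p :: complex poly. degree p = ?D \<and> lead_coeff p = 1 \<and>
      (\<forall>z. poly p z = 0 \<longrightarrow> norm z \<le> ?R) \<longrightarrow> (\<forall>i. norm (coeff p i) \<le> B)"
    using monic_coeff_bound by blast
  show ?thesis
  proof (rule that)
    fix Z :: "complex^'N^'N" assume Z: "\<And>i j. norm (Z $ i $ j) \<le> C"
    define P where "P p \<longleftrightarrow> p \<noteq> 0 \<and> (\<forall>w. poly_mv p Z w = 0)" for p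
    obtain p where p: "P p" "degree p \<le> ?D"
      using exists_annihilator[of Z] by (auto simp: P_def)
    \<comment> \<open>A minimal annihilator: after removal of a factor \<open>[:-a, 1:]\<close> it
      no longer annihilates everything, and any nonzero vector \<open>poly_mv q' Z w\<close> is an
      eigenvector for \<open>a\<close>.\<close>
    obtain q where q: "P q" and qmin: "\<And>q'. P q' \<Longrightarrow> degree q \<le> degree q'"
      using ex_has_least_nat[of P p degree] p(1) by blast
    have "degree q \<le> ?D"
      using qmin[OF p(1)] p(2) by simp
    have root: "norm a \<le> ?R" if a: "poly q a = 0" for a
    proof -
      obtain q' where q': "q = [:-a, 1:] * q'"
        using a by (metis dvdE poly_eq_0_iff_dvd)
      have "q' \<noteq> 0" using q q' by (auto simp: P_def)
      then have "degree q' < degree q"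
        using degree_mult_eq[of "[:-a, 1:]" q'] by (simp add: q')
      then obtain w where "poly_mv q' Z w \<noteq> 0"
        using qmin[of q'] \<open>q' \<noteq> 0\<close> by (auto simp: P_def)
      moreover have "Z *v poly_mv q' Z w = a *s poly_mv q' Z w"
        using q unfolding P_def q' poly_mv_linear_factor by simp
      ultimately show ?thesis
        using eigenvalue_bound[OF Z] by blast
    qed
    define r where "r = monom 1 (?D - degree q) * smult (inverse (lead_coeff q)) q"
    have "q \<noteq> 0" using q by (simp add: P_def)
    have deg: "degree r = ?D"
      using \<open>q \<noteq> 0\<close> \<open>degree q \<le> ?D\<close>
      by (auto simp: r_def degree_mult_eq degree_monom_eq simp del: DIM_cart)
    have lead: "lead_coeff r = 1"
      using \<open>q \<noteq> 0\<close> unfolding r_def lead_coeff_mult lead_coeff_smult lead_coeff_monom by simp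
    have ann: "poly_mv r Z w = 0" for w
    proof -
      have "(((*v) Z) ^^ k) 0 = 0" for k
        by (induction k) auto
      then show ?thesis
        using q by (simp add: r_def poly_mv_monom_mult poly_mv_smult P_def)
    qed
    \<comment> \<open>The power of the variable contributes at most the root 0, which satisfies the
      bound because \<open>C\<close> is nonnegative.\<close>
    have "norm z \<le> ?R" if "poly r z = 0" for z
      using that root True \<open>q \<noteq> 0\<close> by (auto simp: r_def poly_monom)
    then have "norm (coeff r i) \<le> B" for i
      using B deg lead by blast
    moreover have "(((*v) Z) ^^ ?D) w = (\<Sum>i<?D. (- coeff r i) *s (((*v) Z) ^^ i) w)" for w
    proof -
      have "{..?D} = insert ?D {..<?D}" by auto
      then have "(\<Sum>i\<le>?D. coeff r i *s (((*v) Z) ^^ i) w)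
        = (((*v) Z) ^^ ?D) w + (\<Sum>i<?D. coeff r i *s (((*v) Z) ^^ i) w)"
        using lead deg by simp
      then have "(((*v) Z) ^^ ?D) w + (\<Sum>i<?D. coeff r i *s (((*v) Z) ^^ i) w) = 0"
        using ann[of w] poly_mv_eq_sum[of r ?D Z w] deg by simp
      then show ?thesis
        by (simp add: sum_negf add_eq_0_iff2 vec.scale_minus_left)
    qed
    ultimately show "\<exists>c. (\<forall>i. norm (c i) \<le> B) \<and>
      (\<forall>w. (((*v) Z) ^^ ?D) w = (\<Sum>i<?D. c i *s (((*v) Z) ^^ i) w))"
      by (intro exI[of _ "\<lambda>i. - coeff r i"]) (simp del: DIM_cart)
  qed
qed

section \<open>Krylov matrices and the group action\<close>

lemma GL_inverse:
  assumes "g \<in> GL"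
  shows "g ** matrix_inv g = mat 1" "matrix_inv g ** g = mat 1"
proof -
  have "\<exists>h. g ** h = mat 1 \<and> h ** g = mat 1"
    using assms by (simp add: GL_def invertible_def)
  then show "g ** matrix_inv g = mat 1" "matrix_inv g ** g = mat 1"
    unfolding matrix_inv_def by (metis (mono_tags, lifting) someI_ex)+
qed

lemma GL_iff_det: "g \<in> GL \<longleftrightarrow> det g \<noteq> 0"
  by (simp add: GL_def invertible_det_nz)

lemma GL_matrix_inv [simp]: "g \<in> GL \<Longrightarrow> matrix_inv g \<in> GL"
  unfolding GL_def invertible_def using GL_inverse[unfolded GL_def invertible_def] by blast

lemma GL_mult [simp]: "g \<in> GL \<Longrightarrow> h \<in> GL \<Longrightarrow> g ** h \<in> GL"
  by (simp add: GL_iff_det det_mul)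

lemma GL_mat_1 [simp]: "mat 1 \<in> GL"
  by (simp add: GL_iff_det)

lemma matrix_inv_unique_GL:
  fixes g h :: "complex^'N^'N"
  assumes "g ** h = mat 1"
  shows "matrix_inv g = h"
proof -
  have "g \<in> GL"
    using assms unfolding GL_def by (auto simp: invertible_right_inverse)
  then show ?thesis
    using GL_inverse(2) assms by (metis matrix_mul_assoc matrix_mul_lid matrix_mul_rid)
qed

lemma matrix_inv_matrix_inv_GL [simp]: "g \<in> GL \<Longrightarrow> matrix_inv (matrix_inv g) = g"
  by (rule matrix_inv_unique_GL) (rule GL_inverse)

lemma matrix_inv_mult_GL:
  assumes "g \<in> GL" "h \<in> GL"
  shows "matrix_inv (g ** h) = matrix_inv h ** matrix_inv g"
proof (rule matrix_inv_unique_GL)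
  have "(g ** h) ** (matrix_inv h ** matrix_inv g) = g ** (h ** matrix_inv h) ** matrix_inv g"
    by (simp only: matrix_mul_assoc)
  then show "(g ** h) ** (matrix_inv h ** matrix_inv g) = mat 1"
    using assms by (simp add: GL_inverse)
qed

lemma det_matrix_inv_GL:
  assumes "g \<in> GL"
  shows "det (matrix_inv g) = inverse (det g)"
  using arg_cong[OF GL_inverse(1)[OF assms], of det] assms
  by (simp add: det_mul GL_iff_det field_simps)

lemma act_mat_1 [simp]: "act (mat 1) (v :: ('N::finite, 'n::finite) V) = v"
proof -
  have "matrix_inv (mat 1 :: complex^'N^'N) = mat 1"
    by (rule matrix_inv_unique_GL) simp
  then show ?thesis by (simp add: act_def)
qed

lemma act_act:
  assumes "g \<in> GL" "h \<in> GL"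
  shows "act g (act h v) = act (g ** h) v"
  using assms by (simp add: act_def matrix_inv_mult_GL matrix_mul_assoc)

lemma act_inverse [simp]:
  assumes "g \<in> GL"
  shows "act g (act (matrix_inv g) v) = v" "act (matrix_inv g) (act g v) = v"
  using assms by (simp_all add: act_act GL_inverse)

lemma matrix_vector_mult_axis: "A *v axis k 1 = column k (A :: complex^_^_)"
  by (simp add: vec_eq_iff matrix_vector_mult_def axis_def column_def
      if_distrib[where f = "\<lambda>x. _ * x"] cong: if_cong)

section \<open>Krylov vectors and the description of \<open>R_locus\<close> by finitely many
  determinants\<close>

definition krylov :: "('N::finite, 'n::finite) V \<Rightarrow> nat \<times> 'n \<Rightarrow> complex^'N" where
  "krylov v \<kappa> = (((*v) (fst v)) ^^ fst \<kappa>) (column (snd \<kappa>) (snd v))"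

definition krylov_matrix :: "('N::finite, 'n::finite) V \<Rightarrow> ('N \<Rightarrow> nat \<times> 'n) \<Rightarrow> complex^'N^'N" where
  "krylov_matrix v s = (\<chi> i j. krylov v (s j) $ i)"

lemma column_krylov_matrix: "column j (krylov_matrix v s) = krylov v (s j)"
  by (simp add: column_def krylov_matrix_def vec_eq_iff)

lemma krylov_Suc: "krylov v (Suc i, a) = fst v *v krylov v (i, a)"
  by (simp add: krylov_def)

text \<open>The inner factors of the conjugated powers of \<open>Z\<close> cancel. Consequently the
  determinants of Krylov matrices are multiplied by \<open>det g\<close> under the action of
  \<open>g\<close>.\<close>

lemma krylov_act:
  fixes g :: "complex^'N^'N" and v :: "('N::finite, 'n::finite) V"
  assumes "g \<in> GL"
  shows "krylov (act g v) \<kappa> = g *v krylov v \<kappa>"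
proof -
  have "(((*v) (g ** Z ** matrix_inv g)) ^^ i) (g *v w) = g *v (((*v) Z) ^^ i) w" for Z w i
  proof (induction i)
    case (Suc i)
    have "g ** Z ** matrix_inv g ** g = g ** Z"
      using assms by (simp add: GL_inverse flip: matrix_mul_assoc)
    then show ?case
      using Suc by (simp add: matrix_vector_mul_assoc)
  qed simp
  moreover have "column a (g ** A) = g *v column a A" for a and A :: "complex^'n^'N"
    by (simp add: vec_eq_iff column_def matrix_matrix_mult_def matrix_vector_mult_def)
  ultimately show ?thesis
    by (simp add: krylov_def act_def)
qed

lemma krylov_matrix_act: "g \<in> GL \<Longrightarrow> krylov_matrix (act g v) s = g ** krylov_matrix v s"
  by (simp add: vec_eq_iff krylov_matrix_def krylov_act matrix_matrix_mult_def matrix_vector_mult_def)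

lemma krylov_in_coord_ring: "(\<lambda>v. krylov v \<kappa> $ i) \<in> coord_ring"
proof (cases \<kappa>)
  case (Pair m a)
  have "(\<lambda>v. krylov v (m, a) $ i) \<in> coord_ring"
  proof (induction m arbitrary: i)
    case 0
    show ?case by (simp add: krylov_def column_def coord_ring.coord_phi)
  next
    case (Suc m)
    show ?case
      unfolding krylov_Suc matrix_vector_mult_def vec_lambda_beta
      by (intro coord_ring_sum coord_ring.mult coord_ring.coord_Z Suc)
  qed
  then show ?thesis using Pair by simp
qed

lemma det_krylov_matrix_in_coord_ring: "(\<lambda>v. det (krylov_matrix v s)) \<in> coord_ring"
  by (rule coord_ring_det) (simp add: krylov_matrix_def krylov_in_coord_ring)

text \<open>The bound on the exponents makes the family finite. It loses nothing, since
  \<open>bounded_annihilator\<close> expresses the power with exponent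
  \<open>DIM(complex^'N^'N)\<close> through lower ones.\<close>

definition selections :: "('N::finite \<Rightarrow> nat \<times> 'n::finite) set" where
  "selections = UNIV \<rightarrow> {..<DIM(complex^'N^'N)} \<times> UNIV"

lemma finite_selections: "finite (selections :: ('N::finite \<Rightarrow> nat \<times> 'n::finite) set)"
proof -
  have *: "(selections :: ('N \<Rightarrow> nat \<times> 'n) set) = Pi\<^sub>E UNIV (\<lambda>_. {..<DIM(complex^'N^'N)} \<times> UNIV)"
    by (auto simp: selections_def PiE_def extensional_def)
  show ?thesis
    unfolding * by (intro finite_PiE) auto
qed

lemma R_locusI:
  fixes v :: "('N::finite, 'n::finite) V"
  assumes "det (krylov_matrix v s) \<noteq> 0"
  shows "v \<in> R_locus"
proof -
  have "vec.span (columns (krylov_matrix v s)) = UNIV"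
    using assms by (simp flip: invertible_det_nz add: invertible_right_inverse flip: matrix_right_invertible_span_columns)
  moreover have "columns (krylov_matrix v s) \<subseteq> {poly_mv p (fst v) (snd v *v w) | p w. True}"
  proof -
    have "krylov v \<kappa> = poly_mv (monom 1 (fst \<kappa>) * 1) (fst v) (snd v *v axis (snd \<kappa>) 1)" for \<kappa>
      unfolding poly_mv_monom_mult
      by (simp add: krylov_def matrix_vector_mult_axis one_pCons poly_mv_pCons)
    then show ?thesis
      by (auto simp: columns_def column_krylov_matrix)
  qed
  ultimately show ?thesis
    unfolding R_locus_def using vec.span_mono by (auto simp: case_prod_unfold) blast
qed

text \<open>The span \<open>W\<close> of the Krylov vectors with exponent below \<open>?D\<close>
  contains the image of \<open>\<phi>\<close> and is stable under \<open>Z\<close>, so it is the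
  whole space; a basis chosen among its generators provides the columns.\<close>

lemma R_locus_imp_selection:
  fixes v :: "('N::finite, 'n::finite) V"
  assumes "v \<in> R_locus"
  shows "\<exists>s\<in>selections. det (krylov_matrix v s) \<noteq> 0"
proof -
  let ?D = "DIM(complex^'N^'N)"
  define T :: "(nat \<times> 'n) set" where "T = {..<?D} \<times> UNIV"
  define W where "W = vec.span (krylov v ` T)"
  have W: "krylov v \<kappa> \<in> W" if "\<kappa> \<in> T" for \<kappa>
    using that unfolding W_def by (auto intro: vec.span_base)
  have top: "krylov v (?D, a) \<in> W" for a
  proof -
    have entries: "norm (fst v $ i $ j) \<le> norm v" for i j
      using norm_coord_le[of "Inl (i, j)" v] by simp
    obtain B where B: "\<And>Z :: complex^'N^'N. (\<And>i j. norm (Z $ i $ j) \<le> norm v) \<Longrightarrow>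
      \<exists>c. (\<forall>i. norm (c i) \<le> B) \<and>
        (\<forall>w. (((*v) Z) ^^ ?D) w = (\<Sum>i<?D. c i *s (((*v) Z) ^^ i) w))"
      using bounded_annihilator[where C = "norm v"] by blast
    obtain c where c: "\<forall>w. (((*v) (fst v)) ^^ ?D) w = (\<Sum>i<?D. c i *s (((*v) (fst v)) ^^ i) w)"
      using B[OF entries] by blast
    have "krylov v (?D, a) = (\<Sum>i<?D. c i *s krylov v (i, a))"
      by (simp add: krylov_def c del: DIM_cart)
    also have "\<dots> \<in> W"
      using W unfolding W_def by (intro vec.span_sum vec.span_scale) (auto simp: T_def)
    finally show ?thesis .
  qed
  have inv: "fst v *v w \<in> W" if "w \<in> W" for w
    using that unfolding W_def
  proof (induction rule: vec.span_induct_alt)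
    case (step c x y)
    then obtain i a where x: "x = krylov v (i, a)" "i < ?D"
      by (auto simp: T_def)
    have "fst v *v x \<in> W"
    proof (cases "Suc i < ?D")
      case True
      then show ?thesis using W[of "(Suc i, a)"] by (simp add: x T_def krylov_Suc)
    next
      case False
      \<comment> \<open>Only at the last exponent does \<open>Z\<close> leave the generating set;
        there the annihilating relation brings the vector back into \<open>W\<close>.\<close>
      then have "Suc i = ?D" using x by linarith
      then show ?thesis using top[of a] by (metis krylov_Suc x(1))
    qed
    then show ?case
      using step unfolding W_def
      by (simp add: matrix_vector_right_distrib vec.span_add vec.span_scale vector_scalar_commute)
  qed (auto intro: vec.span_zero)
  have pow: "(((*v) (fst v)) ^^ i) w \<in> W" if "w \<in> W" for i w
    using that inv by (induction i) auto
  have phi: "snd v *v w \<in> W" for w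
  proof -
    have "column a (snd v) \<in> W" for a
      using W[of "(0, a)"] by (simp add: krylov_def T_def)
    then show ?thesis
      unfolding matrix_mult_sum W_def by (intro vec.span_sum vec.span_scale)
  qed
  have "poly_mv p (fst v) (snd v *v w) \<in> W" for p w
    unfolding poly_mv_def using pow[OF phi] unfolding W_def by (intro vec.span_sum vec.span_scale)
  then have "vec.span {poly_mv p (fst v) (snd v *v w) | p w. True} \<subseteq> W"
    unfolding W_def by (intro vec.span_minimal) (auto simp: vec.subspace_span)
  then have "W = UNIV"
    using assms by (auto simp: R_locus_def case_prod_unfold)
  obtain B where B: "B \<subseteq> krylov v ` T" "vec.independent B" "krylov v ` T \<subseteq> vec.span B"
    using vec.maximal_independent_subset by blast
  have "W \<subseteq> vec.span B"
    unfolding W_def using B(3) by (intro vec.span_minimal) (auto simp: vec.subspace_span)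
  then have spanB: "vec.span B = UNIV"
    using \<open>W = UNIV\<close> by auto
  have "finite B"
    using B(2) by (rule vec.finiteI_independent)
  moreover have "card B = CARD('N)"
    using vec.dim_eq_card[of B UNIV] B(2) spanB 
    by (metis vec.dim_span_eq_card_independent vec_dim_card)
  ultimately obtain b where b: "bij_betw b (UNIV :: 'N set) B"
    using finite_same_card_bij[of "UNIV :: 'N set" B] by auto
  then have "\<forall>j. \<exists>\<kappa>\<in>T. krylov v \<kappa> = b j"
    using B(1) by (metis UNIV_I bij_betwE imageE subsetD)
  then obtain s where s: "\<And>j. s j \<in> T" "\<And>j. krylov v (s j) = b j"
    by metis
  have "columns (krylov_matrix v s) = B"
    using b by (auto simp: columns_def column_krylov_matrix s bij_betw_def)
  then have "det (krylov_matrix v s) \<noteq> 0"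
    using spanB by (simp flip: invertible_det_nz add: invertible_right_inverse matrix_right_invertible_span_columns)
  moreover have "s \<in> selections"
    using s(1) by (auto simp: selections_def T_def)
  ultimately show ?thesis by blast
qed

lemma R_locus_iff: "v \<in> R_locus \<longleftrightarrow> (\<exists>s\<in>selections. det (krylov_matrix v s) \<noteq> 0)"
  using R_locusI R_locus_imp_selection by blast

lemma act_R_locus_iff: "g \<in> GL \<Longrightarrow> act g v \<in> R_locus \<longleftrightarrow> v \<in> R_locus"
  by (simp add: R_locus_iff krylov_matrix_act det_mul GL_iff_det)

text \<open>An invertible Krylov matrix of \<open>v\<close> can be cancelled from
  \<open>g ** krylov_matrix v s = h ** krylov_matrix v s\<close>.\<close>

lemma act_free_on_R_locus:
  assumes "v \<in> R_locus" "g \<in> GL" "h \<in> GL" "act g v = act h v"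
  shows "g = h"
proof -
  obtain s where "det (krylov_matrix v s) \<noteq> 0"
    using assms(1) R_locus_imp_selection by blast
  then obtain M where "krylov_matrix v s ** M = mat 1"
    by (metis invertible_def invertible_det_nz)
  moreover have "g ** krylov_matrix v s = h ** krylov_matrix v s"
    using assms by (metis krylov_matrix_act)
  ultimately show ?thesis
    by (metis matrix_mul_assoc matrix_mul_rid)
qed

lemma R_locus_nonempty: "\<exists>v :: ('N::finite, 'n::finite) V. v \<in> R_locus"
proof -
  obtain f :: "'N \<Rightarrow> nat" where f: "inj f"
    using finite_imp_inj_to_nat_seg[of "UNIV :: 'N set"] by auto
  \<comment> \<open>A diagonal matrix with distinct eigenvalues, for which the all-ones vector is
    cyclic.\<close>
  define Z :: "complex^'N^'N" where "Z = (\<chi> i j. if i = j then of_nat (f i) else 0)"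
  define \<phi> :: "complex^'n^'N" where "\<phi> = (\<chi> i a. 1)"
  have pow: "(((*v) Z) ^^ m) w $ j = of_nat (f j) ^ m * w $ j" for m w j
    by (induction m) (auto simp: Z_def matrix_vector_mult_def if_distrib[where f = "\<lambda>x. x * _"] cong: if_cong)
  have poly: "poly_mv p Z w $ j = poly p (of_nat (f j)) * w $ j" for p w j
    by (simp add: poly_mv_def pow poly_altdef sum_distrib_right mult.assoc)
  let ?S = "{poly_mv p Z (\<phi> *v w) | p w. True}"
  have "axis i 1 \<in> vec.span ?S" for i
  proof -
    \<comment> \<open>This polynomial vanishes at every eigenvalue except the one with index
      \<open>i\<close>, so \<open>p(Z)\<close> sends the all-ones vector to a nonzero multiple of
      \<open>axis i 1\<close>.\<close>
    define p :: "complex poly" where "p = (\<Prod>j\<in>UNIV - {i}. [:- of_nat (f j), 1:])"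
    have "poly p (of_nat (f j)) = 0" if "j \<noteq> i" for j
      using that by (auto simp: p_def poly_prod prod_zero_iff)
    moreover have nz: "poly p (of_nat (f i)) \<noteq> 0"
      using f by (auto simp: p_def poly_prod prod_zero_iff inj_eq)
    ultimately have "axis i 1 = inverse (poly p (of_nat (f i))) *s poly_mv p Z (\<phi> *v axis (undefined :: 'n) 1)"
      unfolding matrix_vector_mult_axis
      by (auto simp: vec_eq_iff poly column_def \<phi>_def axis_def)
    also have "\<dots> \<in> vec.span ?S"
      by (intro vec.span_scale vec.span_base) blast
    finally show ?thesis .
  qed
  then have "w \<in> vec.span ?S" for w
    by (subst basis_expansion[of w, symmetric]) (intro vec.span_sum vec.span_scale)
  then have "(Z, \<phi>) \<in> R_locus"
    by (auto simp: R_locus_def)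
  then show ?thesis ..
qed

text \<open>Passing from \<open>g\<close> to its inverse turns the weight \<open>- int k\<close>
  into the factor \<open>det g ^ k\<close>, free of inverses and negative exponents.\<close>

lemma semi_invariant_iff:
  assumes X: "\<And>g v. g \<in> GL \<Longrightarrow> v \<in> X \<Longrightarrow> act g v \<in> X"
  shows "semi_invariant X (- int k) f \<longleftrightarrow> (\<forall>g\<in>GL. \<forall>v\<in>X. f (act g v) = det g ^ k * f v)"
proof
  assume f: "semi_invariant X (- int k) f"
  show "\<forall>g\<in>GL. \<forall>v\<in>X. f (act g v) = det g ^ k * f v"
  proof (intro ballI)
    fix g :: "complex^'a^'a" and v assume g: "g \<in> GL" and v: "v \<in> X"
    have "f (act (matrix_inv (matrix_inv g)) v) = det (matrix_inv g) powi (- int k) * f v"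
      using f g v unfolding semi_invariant_def by (metis GL_matrix_inv)
    then show "f (act g v) = det g ^ k * f v"
      using g by (simp add: det_matrix_inv_GL power_int_minus power_inverse)
  qed
next
  assume f: "\<forall>g\<in>GL. \<forall>v\<in>X. f (act g v) = det g ^ k * f v"
  show "semi_invariant X (- int k) f"
    unfolding semi_invariant_def
  proof (intro ballI)
    fix g :: "complex^'a^'a" and v assume "g \<in> GL" "v \<in> X"
    then show "f (act (matrix_inv g) v) = det g powi (- int k) * f v"
      using f by (simp add: det_matrix_inv_GL power_int_minus power_inverse)
  qed
qed

section \<open>Extension by zero\<close>

lemma Zariski_open_det_krylov: "Zariski_open {v. det (krylov_matrix v s) \<noteq> 0}"
  unfolding Zariski_open_def
  by (rule exI[of _ "{\<lambda>v. det (krylov_matrix v s)}"]) (auto simp: det_krylov_matrix_in_coord_ring)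

lemma Zariski_open_imp_open:
  assumes "Zariski_open U"
  shows "open U"
proof -
  obtain S where S: "S \<subseteq> coord_ring" "U = {v. \<exists>p\<in>S. p v \<noteq> 0}"
    using assms by (auto simp: Zariski_open_def)
  have "open {v. p v \<noteq> 0}" if "p \<in> S" for p
    using continuous_on_coord_ring[of p UNIV] that S(1)
    by (intro open_Collect_neq continuous_on_const) auto
  moreover have "U = (\<Union>p\<in>S. {v. p v \<noteq> 0})"
    using S(2) by auto
  ultimately show ?thesis by auto
qed

lemma open_R_locus: "open (R_locus :: ('N::finite, 'n::finite) V set)"
proof -
  have *: "R_locus = (\<Union>s\<in>selections. {v :: ('N, 'n) V. det (krylov_matrix v s) \<noteq> 0})"
    by (auto simp: R_locus_iff)
  show ?thesis
    unfolding * by (intro open_UN ballI Zariski_open_imp_open Zariski_open_det_krylov)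
qed

lemma continuous_on_regular:
  assumes "F \<in> regular_functions X"
  shows "continuous_on X F"
proof (rule continuous_at_imp_continuous_on, rule ballI)
  fix x assume "x \<in> X"
  then obtain U p q where U: "Zariski_open U" "x \<in> U" and pq: "p \<in> coord_ring" "q \<in> coord_ring"
      and eq: "\<forall>y\<in>U. q y \<noteq> 0 \<and> F y = p y / q y"
    using assms unfolding regular_functions_def by blast
  have "continuous_on U (\<lambda>y. p y / q y)"
    using eq pq by (intro continuous_on_divide continuous_on_coord_ring) auto
  then have "continuous_on U F"
    using eq by (simp cong: continuous_on_cong)
  then show "isCont F x"
    using U Zariski_open_imp_open by (metis continuous_on_eq_continuous_at)
qed

text \<open>
  By Cramer's rule the coordinates are quotients of determinants of the same family, so the choice of
  a maximal determinant makes them small.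
\<close>

lemma krylov_coordinates_bound:
  fixes v :: "('N::finite, 'n::finite) V"
  assumes s: "s \<in> selections" "det (krylov_matrix v s) \<noteq> 0"
    and max: "\<And>t. t \<in> selections \<Longrightarrow> norm (det (krylov_matrix v t)) \<le> norm (det (krylov_matrix v s))"
    and \<kappa>: "fst \<kappa> < DIM(complex^'N^'N)"
  shows "norm ((matrix_inv (krylov_matrix v s) *v krylov v \<kappa>) $ j) \<le> 1"
proof -
  let ?M = "krylov_matrix v s"
  define x where "x = matrix_inv ?M *v krylov v \<kappa>"
  have "?M *v x = krylov v \<kappa>"
    using GL_inverse[of ?M] s(2) by (simp add: x_def GL_iff_det matrix_vector_mul_assoc)
  \<comment> \<open>Replacing column \<open>j\<close> by \<open>krylov v \<kappa>\<close> yields the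
    Krylov matrix of another selection, so the numerator in Cramer's rule is again bounded by the
    maximal determinant.\<close>
  then have "(\<chi> i l. if l = j then (?M *v x) $ i else ?M $ i $ l) = krylov_matrix v (s(j := \<kappa>))"
    by (simp add: krylov_matrix_def vec_eq_iff)
  then have "x $ j * det ?M = det (krylov_matrix v (s(j := \<kappa>)))"
    using cramer_lemma[of j ?M x] by simp
  moreover have "s(j := \<kappa>) \<in> selections"
    using s(1) \<kappa> by (cases \<kappa>) (auto simp: selections_def Pi_iff mem_Times_iff)
  ultimately have "norm (x $ j) * norm (det ?M) \<le> 1 * norm (det ?M)"
    using max by (metis mult_1 norm_mult)
  then show ?thesis
    using s(2) by (simp add: x_def)
qed

text \<open>Normalised representatives: the condition on the Krylov matrix fixes the group element,
  and the bound on the coordinates makes the set compact inside \<open>R_locus\<close>.\<close>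

definition slice :: "real \<Rightarrow> ('N \<Rightarrow> nat \<times> 'n) \<Rightarrow> ('N::finite, 'n::finite) V set" where
  "slice C s = {v. krylov_matrix v s = mat 1 \<and> (\<forall>l. norm (coord l v) \<le> C)}"

lemma slice_subset_R_locus: "slice C s \<subseteq> R_locus"
  by (auto simp: slice_def intro!: R_locusI[of _ s])

lemma compact_slice: "compact (slice C s :: ('N::finite, 'n::finite) V set)"
proof -
  have "closed {v. krylov v (s j) $ i = mat 1 $ i $ j}" for i j
    by (intro closed_Collect_eq continuous_on_const continuous_on_coord_ring krylov_in_coord_ring)
  moreover have "closed {v :: ('N, 'n) V. norm (coord l v) \<le> C}" for l
    by (intro closed_Collect_le continuous_intros)
  moreover have "slice C s = (\<Inter>i. \<Inter>j. {v. krylov v (s j) $ i = mat 1 $ i $ j}) \<inter> (\<Inter>l. {v. norm (coord l v) \<le> C})"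
    by (auto simp: slice_def krylov_matrix_def vec_eq_iff)
  ultimately have "closed (slice C s)"
    by (metis (no_types, lifting) closed_INT closed_Int)
  moreover have "bounded (slice C s)"
    by (rule bounded_coord[of _ C]) (auto simp: slice_def)
  ultimately show ?thesis
    by (simp add: compact_eq_bounded_closed)
qed

text \<open>After normalisation by a maximal determinant, every entry of the moved point is a
  coordinate of one of its Krylov vectors. Exponents below \<open>?D\<close> give entries of modulus
  at most 1, and exponent \<open>?D\<close> gives at most \<open>?D * B\<close>, which explains
  \<open>C'\<close>.\<close>

lemma move_to_slice:
  obtains C' where "\<And>v :: ('N::finite, 'n::finite) V. v \<in> R_locus \<Longrightarrow> norm v \<le> C \<Longrightarrow>
    \<exists>s\<in>selections. det (krylov_matrix v s) \<noteq> 0 \<and> act (matrix_inv (krylov_matrix v s)) v \<in> slice C' s"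
proof -
  let ?D = "DIM(complex^'N^'N)"
  obtain B where B: "\<And>Z :: complex^'N^'N. (\<And>i j. norm (Z $ i $ j) \<le> C) \<Longrightarrow>
    \<exists>c. (\<forall>i. norm (c i) \<le> B) \<and>
      (\<forall>w. (((*v) Z) ^^ ?D) w = (\<Sum>i<?D. c i *s (((*v) Z) ^^ i) w))"
    using bounded_annihilator[where C = C] by blast
  define C' where "C' = max 1 (real ?D * B)"
  have "\<exists>s\<in>selections. det (krylov_matrix v s) \<noteq> 0 \<and> act (matrix_inv (krylov_matrix v s)) v \<in> slice C' s"
    if v: "v \<in> R_locus" "norm v \<le> C" for v :: "('N, 'n) V"
  proof -
    have "\<exists>s\<in>selections. \<forall>t\<in>selections. norm (det (krylov_matrix v t)) \<le> norm (det (krylov_matrix v s))"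
    proof -
      let ?A = "(\<lambda>t. norm (det (krylov_matrix v t))) ` selections"
      have "finite ?A" "?A \<noteq> {}"
        using finite_selections R_locus_imp_selection[OF v(1)] by auto
      then have "Max ?A \<in> ?A" "\<forall>a\<in>?A. a \<le> Max ?A"
        by auto
      then show ?thesis by (metis (no_types, lifting) image_iff)
    qed
    then obtain s where s: "s \<in> selections"
      and max: "\<And>t. t \<in> selections \<Longrightarrow> norm (det (krylov_matrix v t)) \<le> norm (det (krylov_matrix v s))"
      by blast
    obtain t where "t \<in> selections" "det (krylov_matrix v t) \<noteq> 0"
      using R_locus_imp_selection[OF v(1)] by blast
    then have nz: "det (krylov_matrix v s) \<noteq> 0"
      using max[of t] by auto
    let ?M = "krylov_matrix v s"
    let ?h = "matrix_inv ?M"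
    define v' where "v' = act ?h v"
    have M: "?M \<in> GL" using nz by (simp add: GL_iff_det)
    have kry: "krylov v' \<kappa> = ?h *v krylov v \<kappa>" for \<kappa>
      using M by (simp add: v'_def krylov_act)
    have small: "norm (krylov v' \<kappa> $ j) \<le> 1" if "fst \<kappa> < ?D" for \<kappa> j
      unfolding kry by (rule krylov_coordinates_bound[OF s nz max that])
    have one: "krylov_matrix v' s = mat 1"
      using M by (simp add: v'_def krylov_matrix_act GL_inverse)
    have top: "norm (krylov v' (?D, a) $ j) \<le> C'" for a j
    proof -
      have entries: "norm (fst v $ i $ j) \<le> C" for i j
        using norm_coord_le[of "Inl (i, j)" v] v(2) by simp
      obtain c where c: "\<forall>i. norm (c i) \<le> B"
          "\<forall>w. (((*v) (fst v)) ^^ ?D) w = (\<Sum>i<?D. c i *s (((*v) (fst v)) ^^ i) w)"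
        using B[OF entries] by blast
      have "krylov v (?D, a) = (\<Sum>i<?D. c i *s krylov v (i, a))"
        by (simp add: krylov_def c del: DIM_cart)
      \<comment> \<open>The relation is transported linearly from \<open>v\<close> to
        \<open>v'\<close>. Its coefficients are thus controlled by the entries of the original
        matrix, before anything is known about those of the moved one.\<close>
      then have "krylov v' (?D, a) = (\<Sum>i<?D. c i *s krylov v' (i, a))"
        by (simp add: kry matrix_vector_mult_sum_right vector_scalar_commute del: DIM_cart)
      then have "norm (krylov v' (?D, a) $ j) \<le> (\<Sum>i<?D. norm (c i * krylov v' (i, a) $ j))"
        by (simp add: norm_sum del: DIM_cart)
      also have "\<dots> \<le> (\<Sum>i<?D. B * 1)"
        unfolding norm_mult
      proof (intro sum_mono mult_mono)
        show "0 \<le> B"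
          using c(1) norm_ge_zero order_trans by blast
      qed (use c(1) small in auto)
      also have "\<dots> \<le> C'"
        by (simp add: C'_def del: DIM_cart)
      finally show ?thesis .
    qed
    have "norm (coord l v') \<le> C'" for l
    proof (cases l)
      case (Inl ij)
      obtain i j where ij: "ij = (i, j)" by fastforce
      obtain m a where ma: "s j = (m, a)" by fastforce
      have "m < ?D"
        using s ma by (auto simp: selections_def Pi_iff mem_Times_iff) (metis fst_conv)
      \<comment> \<open>The selected Krylov vectors of \<open>v'\<close> are the standard basis, so
        raising the exponent by one produces column \<open>j\<close> of the moved matrix.\<close>
      have "krylov v' (m, a) = axis j 1"
        using column_krylov_matrix[of j v' s] unfolding one ma
        by (auto simp: vec_eq_iff column_def mat_def axis_def)
      then have "krylov v' (Suc m, a) = column j (fst v')"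
        by (simp add: krylov_Suc matrix_vector_mult_axis)
      then have "fst v' $ i $ j = krylov v' (Suc m, a) $ i"
        by (simp add: column_def)
      moreover have "norm (krylov v' (Suc m, a) $ i) \<le> C'"
      proof (cases "Suc m = ?D")
        case True
        then show ?thesis using top[of a i] by simp
      next
        case False
        then have "Suc m < ?D" using \<open>m < ?D\<close> by linarith
        then show ?thesis using small[of "(Suc m, a)" i] by (simp add: C'_def)
      qed
      ultimately show ?thesis by (simp add: Inl ij)
    next
      case (Inr ia)
      obtain i a where ia: "ia = (i, a)" by fastforce
      have "snd v' $ i $ a = krylov v' (0, a) $ i"
        by (simp add: krylov_def column_def)
      then show ?thesis
        using small[of "(0, a)" i] by (simp add: Inr ia C'_def)
    qed
    then have "v' \<in> slice C' s"
      using one by (simp add: slice_def)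
    then show ?thesis
      using s nz by (auto simp: v'_def)
  qed
  then show ?thesis by (rule that)
qed

text \<open>\<open>F\<close> is bounded on the finite union of compact slices, and moving back
  multiplies it by a power of a determinant. The sum over all selections dominates the chosen one
  and depends continuously on \<open>v\<close>.\<close>

lemma semi_invariant_growth:
  fixes F :: "('N::finite, 'n::finite) V \<Rightarrow> complex"
  assumes cont: "continuous_on R_locus F" and semi: "semi_invariant R_locus (- int k) F"
  obtains K where "\<And>v. v \<in> R_locus \<Longrightarrow> norm v \<le> C \<Longrightarrow>
    norm (F v) \<le> K * (\<Sum>s\<in>selections. norm (det (krylov_matrix v s))) ^ k"
proof -
  obtain C' where C': "\<And>v :: ('N, 'n) V. v \<in> R_locus \<Longrightarrow> norm v \<le> C \<Longrightarrow>
    \<exists>s\<in>selections. det (krylov_matrix v s) \<noteq> 0 \<and> act (matrix_inv (krylov_matrix v s)) v \<in> slice C' s"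
    using move_to_slice[where C = C] by blast
  have "compact (\<Union>s\<in>selections. slice C' s :: ('N, 'n) V set)"
    using finite_selections compact_slice by blast
  moreover have "continuous_on (\<Union>s\<in>selections. slice C' s) F"
    using slice_subset_R_locus by (intro continuous_on_subset[OF cont]) blast
  ultimately have "bounded (F ` (\<Union>s\<in>selections. slice C' s))"
    by (intro compact_imp_bounded compact_continuous_image)
  then obtain K where K: "0 < K" "\<And>s v. s \<in> selections \<Longrightarrow> v \<in> slice C' s \<Longrightarrow> norm (F v) \<le> K"
    by (auto simp: bounded_pos)
  have F: "F (act g v) = det g ^ k * F v" if "g \<in> GL" "v \<in> R_locus" for g v
    using semi that by (subst (asm) semi_invariant_iff) (auto simp: act_R_locus_iff)
  show ?thesis
  proof (rule that)
    fix v :: "('N, 'n) V" assume v: "v \<in> R_locus" "norm v \<le> C"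
    obtain s where s: "s \<in> selections" "det (krylov_matrix v s) \<noteq> 0"
      and sl: "act (matrix_inv (krylov_matrix v s)) v \<in> slice C' s"
      using C'[OF v] by blast
    let ?M = "krylov_matrix v s"
    have M: "?M \<in> GL" using s by (simp add: GL_iff_det)
    have "F v = det ?M ^ k * F (act (matrix_inv ?M) v)"
      using F[OF M, of "act (matrix_inv ?M) v"] M v(1) by (simp add: act_R_locus_iff)
    then have "norm (F v) = norm (F (act (matrix_inv ?M) v)) * norm (det ?M) ^ k"
      by (simp add: norm_mult norm_power)
    also have "\<dots> \<le> K * (\<Sum>s\<in>selections. norm (det (krylov_matrix v s))) ^ k"
    proof (intro mult_mono power_mono)
      show "norm (det ?M) \<le> (\<Sum>s\<in>selections. norm (det (krylov_matrix v s)))"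
        using s(1) finite_selections by (intro member_le_sum) auto
    qed (use K s(1) sl in auto)
    finally show "norm (F v) \<le> K * (\<Sum>s\<in>selections. norm (det (krylov_matrix v s))) ^ k" .
  qed
qed

lemma zero_extension_continuous:
  fixes F :: "('N::finite, 'n::finite) V \<Rightarrow> complex"
  assumes cont: "continuous_on R_locus F" and semi: "semi_invariant R_locus (- int k) F" and "k > 0"
  shows "continuous_on UNIV (\<lambda>v. if v \<in> R_locus then F v else 0)"
proof (rule continuous_at_imp_continuous_on, rule ballI)
  let ?G = "\<lambda>v. if v \<in> R_locus then F v else 0"
  fix v0 :: "('N, 'n) V"
  show "isCont ?G v0"
  proof (cases "v0 \<in> R_locus")
    case True
    have "continuous_on R_locus ?G"
      using cont by (simp cong: continuous_on_cong)
    then show ?thesis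
      using True continuous_on_eq_continuous_at[OF open_R_locus] by blast
  next
    case False
    obtain K where K: "\<And>v. v \<in> R_locus \<Longrightarrow> norm v \<le> norm v0 + 1 \<Longrightarrow>
      norm (F v) \<le> K * (\<Sum>s\<in>selections. norm (det (krylov_matrix v s))) ^ k"
      using semi_invariant_growth[OF cont semi, of "norm v0 + 1"] by blast
    define h where "h v = K * (\<Sum>s\<in>selections. norm (det (krylov_matrix v s))) ^ k" for v :: "('N, 'n) V"
    have "continuous_on UNIV h"
      unfolding h_def
      by (intro continuous_intros continuous_on_coord_ring det_krylov_matrix_in_coord_ring)
    then have "(h \<longlongrightarrow> h v0) (at v0)"
      unfolding continuous_on_def by blast
    \<comment> \<open>Outside \<open>R_locus\<close> all the determinants vanish, and the exponent
      \<open>k\<close> is positive.\<close>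
    moreover have "h v0 = 0"
      using False \<open>k > 0\<close> by (simp add: h_def R_locus_iff)
    ultimately have "(h \<longlongrightarrow> 0) (at v0)" by simp
    moreover have "\<forall>\<^sub>F v in at v0. norm (?G v) \<le> h v"
    proof -
      have "norm (?G v) \<le> h v" if "dist v v0 < 1" for v
      proof (cases "v \<in> R_locus")
        case True
        have "norm v \<le> norm v0 + norm (v - v0)"
          by (metis add.commute diff_add_cancel norm_triangle_ineq)
        then show ?thesis
          using K[OF True] that True by (simp add: h_def dist_norm)
      next
        case False
        then show ?thesis using \<open>k > 0\<close> by (simp add: h_def R_locus_iff zero_power)
      qed
      then show ?thesis
        unfolding eventually_at by (intro exI[of _ 1]) auto
    qed
    ultimately have "(?G \<longlongrightarrow> 0) (at v0)"
      by (rule Lim_null_comparison[rotated])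
    then show ?thesis
      using False by (simp add: isCont_def)
  qed
qed

text \<open>A single local fraction \<open>p / q\<close> near \<open>x0\<close> is enough: the
  identity between \<open>?G * q\<close> and \<open>p\<close> spreads from a dense open set to the
  whole space by continuity.\<close>

lemma zero_extension_in_coord_ring:
  fixes F :: "('N::finite, 'n::finite) V \<Rightarrow> complex"
  assumes F: "F \<in> regular_functions R_locus" and semi: "semi_invariant R_locus (- int k) F" and "k > 0"
  shows "(\<lambda>v. if v \<in> R_locus then F v else 0) \<in> coord_ring" (is "?G \<in> _")
proof -
  obtain x0 :: "('N, 'n) V" where "x0 \<in> R_locus"
    using R_locus_nonempty by blast
  then obtain U p q where U: "Zariski_open U" "x0 \<in> U" "U \<subseteq> R_locus"
      and pq: "p \<in> coord_ring" "q \<in> coord_ring"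
      and eq: "\<forall>y\<in>U. q y \<noteq> 0 \<and> F y = p y / q y"
    using F unfolding regular_functions_def by blast
  \<comment> \<open>Shrinks \<open>U\<close> to the nonvanishing set of one polynomial, which is
    dense.\<close>
  obtain r where r: "r \<in> coord_ring" "r x0 \<noteq> 0" "{v. r v \<noteq> 0} \<subseteq> U"
    using U unfolding Zariski_open_def by blast
  have cont: "continuous_on UNIV ?G"
    using continuous_on_regular[OF F] semi \<open>k > 0\<close> by (rule zero_extension_continuous)
  have "?G v * q v = p v" for v
  proof (rule continuous_eq_on_dense[OF _ _ coord_ring_nonzero_dense[OF r(1,2)]])
    show "continuous_on UNIV (\<lambda>v. ?G v * q v)"
      using cont pq(2) by (intro continuous_on_mult continuous_on_coord_ring[of q])
    show "continuous_on UNIV p"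
      using pq(1) by (rule continuous_on_coord_ring)
    show "?G v * q v = p v" if "v \<in> {v. r v \<noteq> 0}" for v
      using that r(3) U(3) eq by auto
  qed
  then show ?thesis
    using continuous_quotient_in_coord_ring[OF cont pq, of x0] eq U(2) by blast
qed

section \<open>Sections of the determinant bundle\<close>

lemma in_orbit_self: "x \<in> orbit x"
  unfolding orbit_def using GL_mat_1 act_mat_1 by (metis image_eqI)

lemma orbit_act:
  assumes g: "g \<in> GL"
  shows "orbit (act g x) = orbit x"
proof -
  have *: "orbit (act g x) \<subseteq> orbit x" if "g \<in> GL" for g x
    using that by (auto simp: orbit_def act_act)
  show ?thesis
    using *[OF g, of x] *[OF GL_matrix_inv[OF g], of "act g x"] g by auto
qed

lemma mem_Ldet_point: "(x, c) \<in> Ldet_point k x c"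
  unfolding Ldet_point_def by (rule image_eqI[of _ _ "mat 1"]) auto

lemma Ldet_point_act:
  assumes g: "g \<in> GL"
  shows "Ldet_point k (act g x) (det g ^ k * c) = Ldet_point k x c"
proof -
  have *: "Ldet_point k (act g x) (det g ^ k * c) \<subseteq> Ldet_point k x c" if "g \<in> GL" for g x c
    using that by (auto simp: Ldet_point_def act_act det_mul power_mult_distrib mult.assoc)
  show ?thesis
    using *[OF g, of x c] *[OF GL_matrix_inv[OF g], of "act g x" "det g ^ k * c"] g
    by (auto simp: det_matrix_inv_GL GL_iff_det power_inverse simp flip: mult.assoc)
qed

text \<open>By freeness the base point \<open>y\<close> determines the group element, so two bundle
  points over the same orbit are compared with one common \<open>g\<close>.\<close>

lemma Ldet_point_unique:
  assumes x: "x \<in> R_locus" and "(y, a) \<in> Ldet_point k x c" "(y, b) \<in> Ldet_point k x d"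
  obtains g where "g \<in> GL" "y = act g x" "a = det g ^ k * c" "b = det g ^ k * d"
proof -
  obtain g h where gh: "g \<in> GL" "h \<in> GL" "y = act g x" "y = act h x"
      "a = det g ^ k * c" "b = det h ^ k * d"
    using assms(2,3) by (auto simp: Ldet_point_def)
  moreover have "g = h"
    using gh by (intro act_free_on_R_locus[OF x]) auto
  ultimately show ?thesis using that by blast
qed

text \<open>Trivial stabilisers make the second component over \<open>x\<close> a genuine coordinate
  on the fibre.\<close>

lemma Ldet_point_inject:
  assumes x: "x \<in> R_locus" and eq: "Ldet_point k x c = Ldet_point k x d"
  shows "c = d"
proof -
  have "(x, d) \<in> Ldet_point k x c" "(x, d) \<in> Ldet_point k x d"
    using mem_Ldet_point[of x d k] eq by auto
  then obtain g where g: "g \<in> GL" "x = act g x" "d = det g ^ k * c"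
    by (rule Ldet_point_unique[OF x])
  have "g = mat 1"
    using g by (intro act_free_on_R_locus[OF x]) auto
  then show ?thesis using g by simp
qed

lemma regular_semi_act:
  assumes "F \<in> regular_semi (- int k)" "g \<in> GL" "x \<in> R_locus"
  shows "F (act g x) = det g ^ k * F x"
proof -
  have "semi_invariant R_locus (- int k) F"
    using assms(1) by (simp add: regular_semi_def)
  then show ?thesis
    using assms(2,3) by (subst (asm) semi_invariant_iff) (auto simp: act_R_locus_iff)
qed

lemma descend_orbit:
  assumes F: "F \<in> regular_semi (- int k)" and x: "x \<in> R_locus"
  shows "descend k F (orbit x) = Ldet_point k x (F x)"
proof -
  have eq: "Ldet_point k y (F y) = Ldet_point k x (F x)" if "y \<in> orbit x" for y
    using that x by (auto simp: orbit_def regular_semi_act[OF F] Ldet_point_act)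
  have "orbit x \<in> moduli"
    using x by (simp add: moduli_def)
  then have "descend k F (orbit x) = (\<Union>y\<in>orbit x. Ldet_point k y (F y))"
    by (simp add: descend_def)
  also have "\<dots> = (\<Union>y\<in>orbit x. Ldet_point k x (F x))"
    using eq by simp
  also have "\<dots> = Ldet_point k x (F x)"
    using in_orbit_self by blast
  finally show ?thesis .
qed

lemma section_eqI:
  assumes "s \<in> extensional moduli" "t \<in> extensional moduli"
    and "\<And>x. x \<in> R_locus \<Longrightarrow> s (orbit x) = t (orbit x)"
  shows "s = t"
  using assms by (intro extensionalityI[of s moduli t]) (auto simp: moduli_def)

lemma descend_extensional: "descend k F \<in> extensional moduli"
  by (simp add: descend_def)

lemma descend_in_sections:
  fixes F :: "('N::finite, 'n::finite) V \<Rightarrow> complex"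
  assumes F: "F \<in> regular_semi (- int k)"
  shows "descend k F \<in> Ldet_sections k"
proof -
  have "descend k F m \<in> Ldet_fibre k m" if m: "m \<in> moduli" for m
  proof -
    obtain x where x: "x \<in> R_locus" "m = orbit x"
      using m by (auto simp: moduli_def)
    then show ?thesis
      using in_orbit_self[of x] unfolding Ldet_fibre_def by (auto simp only: descend_orbit[OF F])
  qed
  moreover have "F \<in> regular_functions R_locus"
    using F by (simp add: regular_semi_def)
  ultimately show ?thesis
    using descend_orbit[OF F] descend_extensional by (auto simp: Ldet_sections_def PiE_def)
qed

text \<open>The pullback of a section is automatically semi-invariant: \<open>x\<close> and
  \<open>act g x\<close> have the same orbit, and comparing the two expressions for the section
  there forces the transformation law of \<open>F\<close>.\<close>

lemma section_is_descend:
  assumes s: "s \<in> Ldet_sections k"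
  shows "\<exists>F\<in>regular_semi (- int k). s = descend k F"
proof -
  obtain F where F: "F \<in> regular_functions R_locus"
      and sF: "\<And>x. x \<in> R_locus \<Longrightarrow> s (orbit x) = Ldet_point k x (F x)"
    using s by (auto simp: Ldet_sections_def)
  have "F (act g x) = det g ^ k * F x" if g: "g \<in> GL" and x: "x \<in> R_locus" for g x
  proof (rule Ldet_point_inject)
    show "act g x \<in> R_locus"
      using g x by (simp add: act_R_locus_iff)
    then show "Ldet_point k (act g x) (F (act g x)) = Ldet_point k (act g x) (det g ^ k * F x)"
      using sF[of "act g x"] sF[OF x] g by (simp add: orbit_act Ldet_point_act)
  qed
  then have "semi_invariant R_locus (- int k) F"
    by (subst semi_invariant_iff) (auto simp: act_R_locus_iff)
  then have FS: "F \<in> regular_semi (- int k)"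
    using F by (simp add: regular_semi_def)
  have "s = descend k F"
    using s by (intro section_eqI descend_extensional)
      (auto simp: Ldet_sections_def PiE_def sF descend_orbit[OF FS])
  then show ?thesis using FS by blast
qed

lemma inj_on_descend: "inj_on (descend k) (regular_semi (- int k))"
proof (rule inj_onI)
  fix F G :: "('a, 'b) V \<Rightarrow> complex"
  assume F: "F \<in> regular_semi (- int k)" and G: "G \<in> regular_semi (- int k)"
    and eq: "descend k F = descend k G"
  show "F = G"
  proof (rule extensionalityI[of _ R_locus])
    show "F \<in> extensional R_locus" "G \<in> extensional R_locus"
      using F G by (auto simp: regular_semi_def regular_functions_def)
    show "F x = G x" if "x \<in> R_locus" for x
      using that descend_orbit[OF F that] descend_orbit[OF G that] eq
      by (auto intro: Ldet_point_inject)
  qed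
qed

lemma bij_betw_descend: "bij_betw (descend k) (regular_semi (- int k)) (Ldet_sections k)"
  unfolding bij_betw_def
  using inj_on_descend descend_in_sections section_is_descend by blast

text \<open>\<open>section_add\<close> pairs values lying over the same base point; freeness ensures
  that both carry the same factor \<open>det g ^ k\<close>.\<close>

lemma descend_add:
  fixes F G :: "('N::finite, 'n::finite) V \<Rightarrow> complex"
  assumes F: "F \<in> regular_semi (- int k)" and G: "G \<in> regular_semi (- int k)"
    and H: "(\<lambda>x\<in>R_locus. F x + G x) \<in> regular_semi (- int k)"
  shows "descend k (\<lambda>x\<in>R_locus. F x + G x) = section_add (descend k F) (descend k G)"
proof (rule section_eqI)
  show "section_add (descend k F) (descend k G) \<in> extensional moduli"
    by (simp add: section_add_def)
  fix x :: "('N, 'n) V" assume x: "x \<in> R_locus"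
  have "{(y, a + b) | y a b. (y, a) \<in> Ldet_point k x (F x) \<and> (y, b) \<in> Ldet_point k x (G x)}
      = Ldet_point k x (F x + G x)" (is "?L = _")
  proof (intro equalityI subsetI)
    fix z assume "z \<in> ?L"
    then obtain y a b where z: "z = (y, a + b)"
        and ab: "(y, a) \<in> Ldet_point k x (F x)" "(y, b) \<in> Ldet_point k x (G x)"
      by blast
    obtain g where "g \<in> GL" "y = act g x" "a = det g ^ k * F x" "b = det g ^ k * G x"
      by (rule Ldet_point_unique[OF x ab])
    then show "z \<in> Ldet_point k x (F x + G x)"
      by (auto simp: z Ldet_point_def distrib_left)
  next
    fix z assume "z \<in> Ldet_point k x (F x + G x)"
    then obtain g where "g \<in> GL" "z = (act g x, det g ^ k * F x + det g ^ k * G x)"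
      by (auto simp: Ldet_point_def distrib_left)
    then show "z \<in> ?L"
      unfolding Ldet_point_def by blast
  qed
  then show "descend k (\<lambda>x\<in>R_locus. F x + G x) (orbit x) = section_add (descend k F) (descend k G) (orbit x)"
    using x by (simp add: section_add_def moduli_def descend_orbit[OF F] descend_orbit[OF G] descend_orbit[OF H])
qed (rule descend_extensional)

lemma descend_scale:
  fixes F :: "('N::finite, 'n::finite) V \<Rightarrow> complex"
  assumes F: "F \<in> regular_semi (- int k)" and H: "(\<lambda>x\<in>R_locus. c * F x) \<in> regular_semi (- int k)"
  shows "descend k (\<lambda>x\<in>R_locus. c * F x) = section_scale c (descend k F)"
proof (rule section_eqI)
  show "section_scale c (descend k F) \<in> extensional moduli"
    by (simp add: section_scale_def)
  fix x :: "('N, 'n) V" assume x: "x \<in> R_locus"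
  have "{(y, c * a) | y a. (y, a) \<in> Ldet_point k x (F x)} = Ldet_point k x (c * F x)"
    by (auto simp: Ldet_point_def mult.left_commute)
  then show "descend k (\<lambda>x\<in>R_locus. c * F x) (orbit x) = section_scale c (descend k F) (orbit x)"
    using x by (simp add: section_scale_def moduli_def descend_orbit[OF F] descend_orbit[OF H])
qed (rule descend_extensional)

section \<open>Restriction of polynomial semi-invariants to \<open>R_locus\<close>\<close>

lemma coord_ring_semi_act:
  assumes "f \<in> coord_ring_semi (- int k)" "g \<in> GL"
  shows "f (act g v) = det g ^ k * f v"
proof -
  have "semi_invariant UNIV (- int k) f"
    using assms(1) by (simp add: coord_ring_semi_def)
  then show ?thesis
    using assms(2) by (subst (asm) semi_invariant_iff) blast+
qed

lemma coord_ring_semiI: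
  assumes "f \<in> coord_ring" "\<And>g v. g \<in> GL \<Longrightarrow> f (act g v) = det g ^ k * f v"
  shows "f \<in> coord_ring_semi (- int k)"
  using assms by (auto simp: coord_ring_semi_def semi_invariant_iff)

lemma coord_ring_semi_add:
  assumes "f \<in> coord_ring_semi (- int k)" "g \<in> coord_ring_semi (- int k)"
  shows "(\<lambda>v. f v + g v) \<in> coord_ring_semi (- int k)"
proof (rule coord_ring_semiI)
  show "(\<lambda>v. f v + g v) \<in> coord_ring"
    using assms by (auto simp: coord_ring_semi_def intro: coord_ring.add)
qed (use assms in \<open>simp add: coord_ring_semi_act distrib_left\<close>)

lemma coord_ring_semi_scale:
  assumes "f \<in> coord_ring_semi (- int k)"
  shows "(\<lambda>v. c * f v) \<in> coord_ring_semi (- int k)"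
proof (rule coord_ring_semiI)
  show "(\<lambda>v. c * f v) \<in> coord_ring"
    using assms by (auto simp: coord_ring_semi_def intro: coord_ring_cmult)
qed (use assms in \<open>simp add: coord_ring_semi_act mult.left_commute\<close>)

lemma restrict_coord_ring_regular:
  fixes f :: "('N::finite, 'n::finite) V \<Rightarrow> complex"
  assumes f: "f \<in> coord_ring"
  shows "restrict f R_locus \<in> regular_functions R_locus"
  unfolding regular_functions_def
proof (intro CollectI conjI ballI)
  fix x :: "('N, 'n) V" assume x: "x \<in> R_locus"
  obtain s where s: "det (krylov_matrix x s) \<noteq> 0"
    using R_locus_imp_selection[OF x] by blast
  let ?U = "{v :: ('N, 'n) V. det (krylov_matrix v s) \<noteq> 0}"
  show "\<exists>U. Zariski_open U \<and> x \<in> U \<and> U \<subseteq> R_locus \<and>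
     (\<exists>p\<in>coord_ring. \<exists>q\<in>coord_ring. \<forall>y\<in>U. q y \<noteq> 0 \<and> restrict f R_locus y = p y / q y)"
  proof (intro exI[of _ ?U] conjI)
    show sub: "?U \<subseteq> R_locus" using R_locusI by blast
    show "\<exists>p\<in>coord_ring. \<exists>q\<in>coord_ring. \<forall>y\<in>?U. q y \<noteq> 0 \<and> restrict f R_locus y = p y / q y"
      using sub f coord_ring.const[of 1]
      by (intro bexI[of _ f] bexI[of _ "\<lambda>_. 1"]) auto
  qed (use s Zariski_open_det_krylov in auto)
qed auto

lemma restrict_in_regular_semi:
  assumes f: "f \<in> coord_ring_semi (- int k)"
  shows "restrict f R_locus \<in> regular_semi (- int k)"
proof -
  have "semi_invariant R_locus (- int k) (restrict f R_locus)"
    by (subst semi_invariant_iff) (auto simp: act_R_locus_iff coord_ring_semi_act[OF f])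
  then show ?thesis
    using f by (auto simp: regular_semi_def coord_ring_semi_def restrict_coord_ring_regular)
qed

text \<open>\<open>R_locus\<close> contains the nonvanishing set of a nonzero Krylov determinant,
  which is dense. This is injectivity of restriction.\<close>

lemma coord_ring_eq_on_R_locus:
  fixes f g :: "('N::finite, 'n::finite) V \<Rightarrow> complex"
  assumes "f \<in> coord_ring" "g \<in> coord_ring" and eq: "\<And>v. v \<in> R_locus \<Longrightarrow> f v = g v"
  shows "f = g"
proof
  fix v
  obtain x :: "('N, 'n) V" and s where s: "det (krylov_matrix x s) \<noteq> 0"
    using R_locus_nonempty R_locus_imp_selection by blast
  show "f v = g v"
    by (rule continuous_eq_on_dense[OF continuous_on_coord_ring[OF assms(1)] continuous_on_coord_ring[OF assms(2)]
        coord_ring_nonzero_dense[OF det_krylov_matrix_in_coord_ring s]])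
      (use eq R_locusI in blast)
qed

text \<open>Surjectivity is extension by zero, and this is where \<open>k > 0\<close>
  enters.\<close>

lemma bij_betw_restrict:
  assumes "k > 0"
  shows "bij_betw (\<lambda>f. restrict f R_locus)
    (coord_ring_semi (- int k) :: (('N::finite, 'n::finite) V \<Rightarrow> complex) set) (regular_semi (- int k))"
proof (rule bij_betw_imageI)
  show "inj_on (\<lambda>f. restrict f R_locus) (coord_ring_semi (- int k) :: (('N, 'n) V \<Rightarrow> complex) set)"
  proof (rule inj_onI)
    fix f g :: "('N, 'n) V \<Rightarrow> complex"
    assume "f \<in> coord_ring_semi (- int k)" "g \<in> coord_ring_semi (- int k)"
      and eq: "restrict f R_locus = restrict g R_locus"
    moreover have "f v = g v" if "v \<in> R_locus" for v
      using fun_cong[OF eq, of v] that by simp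
    ultimately show "f = g"
      by (intro coord_ring_eq_on_R_locus) (auto simp: coord_ring_semi_def)
  qed
  show "(\<lambda>f. restrict f R_locus) ` coord_ring_semi (- int k) = (regular_semi (- int k) :: (('N, 'n) V \<Rightarrow> complex) set)"
  proof (intro equalityI subsetI)
    fix F :: "('N, 'n) V \<Rightarrow> complex" assume F: "F \<in> regular_semi (- int k)"
    let ?G = "\<lambda>v. if v \<in> R_locus then F v else 0"
    have G: "?G \<in> coord_ring_semi (- int k)"
    proof (rule coord_ring_semiI)
      show "?G \<in> coord_ring"
        using F \<open>k > 0\<close> by (intro zero_extension_in_coord_ring) (auto simp: regular_semi_def)
      \<comment> \<open>Both \<open>R_locus\<close> and its complement are stable under the action,
        so the extension by zero keeps the transformation law.\<close>
      show "?G (act g v) = det g ^ k * ?G v" if "g \<in> GL" for g v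
        using that by (simp add: act_R_locus_iff regular_semi_act[OF F])
    qed
    have eq: "F = restrict ?G R_locus"
      using F by (intro extensionalityI[of F R_locus]) (auto simp: regular_semi_def regular_functions_def)
    show "F \<in> (\<lambda>f. restrict f R_locus) ` coord_ring_semi (- int k)"
      using eq G by (rule image_eqI)
  qed (auto simp: restrict_in_regular_semi)
qed

theorem proposition4p2:
  fixes k :: nat
  assumes "k > 0"
  shows
    "linear_iso_between
       (coord_ring_semi (- int k) :: (('N::finite, 'n::finite) V \<Rightarrow> complex) set)
       (\<lambda>f g v. f v + g v) (\<lambda>c f v. c * f v)
       (regular_semi (- int k))
       (\<lambda>F G. \<lambda>x\<in>R_locus. F x + G x) (\<lambda>c F. \<lambda>x\<in>R_locus. c * F x)
       (\<lambda>f. restrict f R_locus)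
     \<and> linear_iso_between
       (CS_Hilbert k :: (('N, 'n) V \<Rightarrow> complex) set)
       (\<lambda>f g v. f v + g v) (\<lambda>c f v. c * f v)
       (Ldet_sections k) section_add section_scale
       (\<lambda>f. descend k (restrict f R_locus))"
proof (intro conjI)
  let ?A = "coord_ring_semi (- int k) :: (('N, 'n) V \<Rightarrow> complex) set"
  have add: "restrict (\<lambda>v. f v + g v) R_locus = (\<lambda>x\<in>R_locus. restrict f R_locus x + restrict g R_locus x)"
    for f g :: "('N, 'n) V \<Rightarrow> complex"
    by auto
  have scale: "restrict (\<lambda>v. c * f v) R_locus = (\<lambda>x\<in>R_locus. c * restrict f R_locus x)"
    for c and f :: "('N, 'n) V \<Rightarrow> complex"
    by auto
  show "linear_iso_between ?A (\<lambda>f g v. f v + g v) (\<lambda>c f v. c * f v) (regular_semi (- int k))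
       (\<lambda>F G. \<lambda>x\<in>R_locus. F x + G x) (\<lambda>c F. \<lambda>x\<in>R_locus. c * F x) (\<lambda>f. restrict f R_locus)"
    unfolding linear_iso_between_def
    using bij_betw_restrict[OF assms] coord_ring_semi_add coord_ring_semi_scale add scale by blast
  \<comment> \<open>The second isomorphism is the first one followed by descent to the
    quotient.\<close>
  have "bij_betw (descend k \<circ> (\<lambda>f. restrict f R_locus)) ?A (Ldet_sections k)"
    using bij_betw_restrict[OF assms] bij_betw_descend by (rule bij_betw_trans)
  moreover have "descend k (restrict (\<lambda>v. f v + g v) R_locus)
      = section_add (descend k (restrict f R_locus)) (descend k (restrict g R_locus))"
    if "f \<in> ?A" "g \<in> ?A" for f g
    using restrict_in_regular_semi[OF coord_ring_semi_add[OF that]]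
    unfolding add[of f g] by (rule descend_add[OF that[THEN restrict_in_regular_semi]])
  moreover have "descend k (restrict (\<lambda>v. c * f v) R_locus) = section_scale c (descend k (restrict f R_locus))"
    if "f \<in> ?A" for c f
    using restrict_in_regular_semi[OF coord_ring_semi_scale[OF that, of c]]
    unfolding scale[of c f] by (rule descend_scale[OF that[THEN restrict_in_regular_semi]])
  ultimately show "linear_iso_between (CS_Hilbert k) (\<lambda>f g v. f v + g v) (\<lambda>c f v. c * f v)
       (Ldet_sections k) section_add section_scale (\<lambda>f :: ('N, 'n) V \<Rightarrow> complex. descend k (restrict f R_locus))"
    unfolding linear_iso_between_def CS_Hilbert_def
    using coord_ring_semi_add coord_ring_semi_scale by (auto simp: o_def)
qed

end
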